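(* Consider the single-cell uplink with predicted CSI (predictor order $p$) and MRC receivers described in the context, with $K$, $\tau$, $\alpha$, $p$ and $\beta_1,\dots,\beta_K$ fixed, and fix $E_u>0$. Each user can scale down its transmit power at most by $p_u=E_u/\sqrt M$, in the following sense: for every $k\in\{1,\dots,K\}$, if $p_u=E_u/\sqrt M$ then $$R_k^{\mathrm{p,mrc}}\longrightarrow\log_2\left(1+\alpha^2\sum_{j=0}^p\alpha^{2j}\,\tau E_u^2\beta_k^2\right)\qquad(M\to\infty),$$ whereas if $p_u=E_u/M^\gamma$ with $\gamma>\frac12$ then $R_k^{\mathrm{p,mrc}}\to0$ as $M\to\infty$.
   Context: System: a base station (BS) with $M$ antennas and $K\le M$ single-antenna users; $p_u>0$ is the transmit power per user, $\tau\ge K$ the (integer) training length, $p_p:=\tau p_u$, and $\beta_1,\dots,\beta_K>0$ are constants. The channel of user $k$ is a stationary process $\mathbf g_k[n]\in\mathbb C^M$ with i.i.d. $\mathcal{CN}(0,\beta_k)$ entries, independent across users, satisfying $\mathbf g_k[n+1]=\alpha\mathbf g_k[n]+\mathbf e_k[n+1]$, with $\alpha$ real, $0\le|\alpha|\le1$ (convention $0^0=1$), and $\mathbf e_k[n+1]$ having i.i.d. $\mathcal{CN}(0,(1-\alpha^2)\beta_k)$ entries, independent over time and of the past. The BS observes $\tilde{\mathbf y}_k[n]=\mathbf g_k[n]+\frac1{\sqrt{p_p}}\mathbf b_k[n]$, with $\mathbf b_k[n]$ having i.i.d. $\mathcal{CN}(0,1)$ entries, independent over $k$ and $n$ and of the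 channels. Prediction: let $p\ge0$ be an integer (predictor order), $\bar{\mathbf y}_k[n]=[\tilde{\mathbf y}_k^T[n],\tilde{\mathbf y}_k^T[n-1],\dots,\tilde{\mathbf y}_k^T[n-p]]^T$, $\delta(p,\alpha)=[1\ \alpha\ \cdots\ \alpha^p]$, $\Delta(p,\alpha)$ the $(p+1)\times(p+1)$ matrix with $(i,j)$ entry $\alpha^{|i-j|}$, and $$\mathbf T_k(p,\alpha)=\beta_k[\Delta(p,\alpha)\otimes\mathbf I_M]+\tfrac1{p_p}\mathbf I_{M(p+1)}.$$ The predicted channel is $\breve{\mathbf g}_k[n+1]=\mathbf q_k\bar{\mathbf y}_k[n]$ with $\mathbf q_k=\alpha\beta_k[\delta(p,\alpha)\otimes\mathbf I_M]\mathbf T_k^{-1}(p,\alpha)$. Its covariance matrix is $\alpha^2\boldsymbol\Theta_k(p,\alpha)$, where $$\boldsymbol\Theta_k(p,\alpha)=\beta_k^2[\delta(p,\alpha)\otimes\mathbf I_M]\mathbf T_k^{-1}(p,\alpha)[\delta(p,\alpha)\otimes\mathbf I_M]^\dagger .$$ Rate: with linear detector vector $\hat{\mathbf a}_k$ and $\breve{\mathbf g}_i=\breve{\mathbf g}_i[n+1]$, the achievable rate of user $k$ is defined as $R_k^{\mathrm p}=\mathrm E\{\log_2(1+\mathrm{SINR}_k^{\mathrm p})\}$ with $$\mathrm{SINR}_k^{\mathrm p}=\frac{p_u|\hat{\mathbf a}_k^\dagger\breve{\mathbf g}_k|^2}{p_u\sum_{i\ne k}|\hat{\mathbf a}_k^\dagger\breve{\mathbf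 g}_i|^2+\|\hat{\mathbf a}_k\|^2\left(p_u\sum_{i=1}^K\frac1M\mathrm{tr}(\beta_i\mathbf I_M-\alpha^2\boldsymbol\Theta_i(p,\alpha))+1\right)},$$ read as $0$ when $\hat{\mathbf a}_k=0$. The MRC receiver is $\hat{\mathbf a}_k=\breve{\mathbf g}_k[n+1]$, and the resulting rate is denoted $R_k^{\mathrm{p,mrc}}$. *)

theory Defs
  imports
    "HOL-Probability.Probability"
    "Jordan_Normal_Form.Gauss_Jordan_Elimination"
    "Jordan_Normal_Form.Schur_Decomposition"
begin

text \<open>Vectors and matrices are those of Jordan_Normal_Form, whose dimensions are values; its
  notation collides with that of the type-indexed vectors of HOL-Analysis.\<close>

no_notation vec_nth (infixl \<open>$\<close> 90)
no_notation inner (infix \<open>\<bullet>\<close> 70)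
hide_const (open) Finite_Cartesian_Product.vec Finite_Cartesian_Product.mat

definition kronecker :: "complex mat \<Rightarrow> complex mat \<Rightarrow> complex mat" (infixl \<open>\<otimes>\<^sub>K\<close> 75) where
  "A \<otimes>\<^sub>K B = mat (dim_row A * dim_row B) (dim_col A * dim_col B)
     (\<lambda>(i, j). A $$ (i div dim_row B, j div dim_col B) * B $$ (i mod dim_row B, j mod dim_col B))"

definition mat_trace :: "complex mat \<Rightarrow> complex" where
  "mat_trace A = (\<Sum>i<dim_row A. A $$ (i, i))"

definition sq_norm_cvec :: "complex vec \<Rightarrow> real" where
  "sq_norm_cvec v = (\<Sum>i<dim_vec v. (cmod (v $ i))\<^sup>2)"

text \<open>The circularly symmetric law $\mathcal{CN}(0,v)$ for $v \ge 0$: independent real and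
  imaginary parts of variance $v/2$ each. It is the point mass at $0$ when $v = 0$.\<close>

definition complex_normal :: "real \<Rightarrow> complex measure" where
  "complex_normal v =
     (if v = 0 then return borel 0
      else distr (density lborel (normal_density 0 (sqrt (v / 2)))
                    \<Otimes>\<^sub>M density lborel (normal_density 0 (sqrt (v / 2))))
             borel (\<lambda>(x, y). Complex x y))"

text \<open>A vector-valued process is given by its entries, \<open>X n m \<omega>\<close> being entry \<open>m\<close> at time \<open>n\<close>.
  The restriction of the process to the times in \<open>T\<close> is a random element of a product space.\<close>

definition trajectory ::
    "nat \<Rightarrow> int set \<Rightarrow> (int \<Rightarrow> nat \<Rightarrow> 'w \<Rightarrow> complex) \<Rightarrow> 'w \<Rightarrow> int \<times> nat \<Rightarrow> complex" where
  "trajectory M T X \<omega> = (\<lambda>(n, m) \<in> T \<times> {..<M}. X n m \<omega>)"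

abbreviation trajectory_space :: "nat \<Rightarrow> int set \<Rightarrow> (int \<times> nat \<Rightarrow> complex) measure" where
  "trajectory_space M T \<equiv> (\<Pi>\<^sub>M _ \<in> T \<times> {..<M}. borel)"

definition family_trajectory ::
    "nat set \<Rightarrow> nat \<Rightarrow> (nat \<Rightarrow> int \<Rightarrow> nat \<Rightarrow> 'w \<Rightarrow> complex) \<Rightarrow> 'w \<Rightarrow> nat \<times> int \<times> nat \<Rightarrow> complex"
  where
  "family_trajectory U M X \<omega> = (\<lambda>(k, n, m) \<in> U \<times> UNIV \<times> {..<M}. X k n m \<omega>)"

abbreviation family_space ::
    "nat set \<Rightarrow> nat \<Rightarrow> (nat \<times> int \<times> nat \<Rightarrow> complex) measure" where
  "family_space U M \<equiv> (\<Pi>\<^sub>M _ \<in> U \<times> UNIV \<times> {..<M}. borel)"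

text \<open>Users are numbered \<open>1..K\<close>, antennas \<open>0..M-1\<close>, and time is two-sided. The processes \<open>g\<close>,
  \<open>e\<close> and \<open>b\<close> (channel, innovation, observation noise) take user, time, antenna and outcome.\<close>

locale uplink = prob_space \<Omega>
  for \<Omega> :: "'w measure" +
  fixes M K \<tau> :: nat
    and p_u \<alpha> :: real
    and \<beta> :: "nat \<Rightarrow> real"
    and g e b :: "nat \<Rightarrow> int \<Rightarrow> nat \<Rightarrow> 'w \<Rightarrow> complex"
  assumes users_le_antennas: "K \<le> M"
    and training_length: "K \<le> \<tau>"
    and power_pos: "0 < p_u"
    and fading_pos: "\<And>k. k \<in> {1..K} \<Longrightarrow> 0 < \<beta> k"
    and alpha_bound: "\<bar>\<alpha>\<bar> \<le> 1"
    and channel_stationary: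
      "\<And>k h. k \<in> {1..K} \<Longrightarrow>
         distr \<Omega> (trajectory_space M UNIV) (trajectory M UNIV (\<lambda>n. g k (n + h)))
         = distr \<Omega> (trajectory_space M UNIV) (trajectory M UNIV (g k))"
    and channel_entries_indep:
      "\<And>k n. k \<in> {1..K} \<Longrightarrow> indep_vars (\<lambda>_. borel) (g k n) {..<M}"
    and channel_entries_law:
      "\<And>k n m. k \<in> {1..K} \<Longrightarrow> m < M \<Longrightarrow> distr \<Omega> borel (g k n m) = complex_normal (\<beta> k)"
    and channels_indep:
      "indep_vars (\<lambda>_. trajectory_space M UNIV) (\<lambda>k. trajectory M UNIV (g k)) {1..K}"
    and channel_recursion:
      "\<And>k n m. k \<in> {1..K} \<Longrightarrow> m < M \<Longrightarrow>
         AE \<omega> in \<Omega>. g k (n + 1) m \<omega> = complex_of_real \<alpha> * g k n m \<omega> + e k (n + 1) m \<omega>"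
    and innovation_entries_indep:
      "\<And>k n. k \<in> {1..K} \<Longrightarrow> indep_vars (\<lambda>_. borel) (e k n) {..<M}"
    and innovation_entries_law:
      "\<And>k n m. k \<in> {1..K} \<Longrightarrow> m < M \<Longrightarrow>
         distr \<Omega> borel (e k n m) = complex_normal ((1 - \<alpha>\<^sup>2) * \<beta> k)"
    and innovation_indep_time:
      "\<And>k. k \<in> {1..K} \<Longrightarrow>
         indep_vars (\<lambda>n. trajectory_space M {n}) (\<lambda>n. trajectory M {n} (e k)) UNIV"
    and innovation_indep_past:
      "\<And>k n. k \<in> {1..K} \<Longrightarrow>
         indep_var (trajectory_space M {n + 1}) (trajectory M {n + 1} (e k))
                   (trajectory_space M {..n}) (trajectory M {..n} (g k))"
    and noise_indep:
      "indep_vars (\<lambda>_. borel) (\<lambda>(k, n, m). b k n m) ({1..K} \<times> UNIV \<times> {..<M})"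
    and noise_law:
      "\<And>k n m. k \<in> {1..K} \<Longrightarrow> m < M \<Longrightarrow> distr \<Omega> borel (b k n m) = complex_normal 1"
    and noise_indep_channels:
      "indep_var (family_space {1..K} M) (family_trajectory {1..K} M b)
                 (family_space {1..K} M) (family_trajectory {1..K} M g)"
begin

definition p_p :: real where
  "p_p = real \<tau> * p_u"

definition observation :: "nat \<Rightarrow> int \<Rightarrow> 'w \<Rightarrow> complex vec" where
  "observation k n \<omega> =
     vec M (\<lambda>m. g k n m \<omega> + complex_of_real (1 / sqrt p_p) * b k n m \<omega>)"

text \<open>Block \<open>j\<close> of the stacked vector, \<open>j = 0..p\<close>, is the observation at time \<open>n - j\<close>.\<close>

definition stacked_observation :: "nat \<Rightarrow> nat \<Rightarrow> int \<Rightarrow> 'w \<Rightarrow> complex vec" where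
  "stacked_observation p k n \<omega> =
     vec (M * (p + 1)) (\<lambda>r. observation k (n - int (r div M)) \<omega> $ (r mod M))"

definition \<delta> :: "nat \<Rightarrow> complex mat" where
  "\<delta> p = mat 1 (p + 1) (\<lambda>(_, j). complex_of_real (\<alpha> ^ j))"

definition \<Delta> :: "nat \<Rightarrow> complex mat" where
  "\<Delta> p = mat (p + 1) (p + 1) (\<lambda>(i, j). complex_of_real (\<alpha> ^ nat \<bar>int i - int j\<bar>))"

definition T :: "nat \<Rightarrow> nat \<Rightarrow> complex mat" where
  "T p k = complex_of_real (\<beta> k) \<cdot>\<^sub>m (\<Delta> p \<otimes>\<^sub>K 1\<^sub>m M)
           + complex_of_real (1 / p_p) \<cdot>\<^sub>m 1\<^sub>m (M * (p + 1))"

text \<open>\<open>T p k\<close> is positive definite, so its inverse exists.\<close>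

definition T_inv :: "nat \<Rightarrow> nat \<Rightarrow> complex mat" where
  "T_inv p k = the (mat_inverse (T p k))"

definition q :: "nat \<Rightarrow> nat \<Rightarrow> complex mat" where
  "q p k = complex_of_real (\<alpha> * \<beta> k) \<cdot>\<^sub>m ((\<delta> p \<otimes>\<^sub>K 1\<^sub>m M) * T_inv p k)"

definition \<Theta> :: "nat \<Rightarrow> nat \<Rightarrow> complex mat" where
  "\<Theta> p k = complex_of_real ((\<beta> k)\<^sup>2) \<cdot>\<^sub>m
     ((\<delta> p \<otimes>\<^sub>K 1\<^sub>m M) * T_inv p k * mat_adjoint (\<delta> p \<otimes>\<^sub>K 1\<^sub>m M))"

text \<open>The prediction of the channel at time \<open>n + 1\<close> from the observations up to time \<open>n\<close>.\<close>

definition predicted_channel :: "nat \<Rightarrow> nat \<Rightarrow> int \<Rightarrow> 'w \<Rightarrow> complex vec" where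
  "predicted_channel p k n \<omega> = q p k *\<^sub>v stacked_observation p k n \<omega>"

text \<open>The product \<open>v \<bullet>c a\<close> is $a^\dagger v$. The trace is real since the matrix is Hermitian. A zero
  detector gives \<open>0 / 0 = 0\<close>.\<close>

definition sinr :: "nat \<Rightarrow> nat \<Rightarrow> int \<Rightarrow> complex vec \<Rightarrow> 'w \<Rightarrow> real" where
  "sinr p k n a \<omega> =
     p_u * (cmod (predicted_channel p k n \<omega> \<bullet>c a))\<^sup>2 /
     (p_u * (\<Sum>i \<in> {1..K} - {k}. (cmod (predicted_channel p i n \<omega> \<bullet>c a))\<^sup>2)
      + sq_norm_cvec a *
          (p_u * (\<Sum>i = 1..K. 1 / real M *
             Re (mat_trace (complex_of_real (\<beta> i) \<cdot>\<^sub>m 1\<^sub>m M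
                            - complex_of_real (\<alpha>\<^sup>2) \<cdot>\<^sub>m \<Theta> p i))) + 1))"

text \<open>The detector is chosen per outcome. By Cauchy--Schwarz the integrand lies between \<open>0\<close> and
  \<open>p_u / ln 2\<close> times the squared norm of the predicted channel, so the rate of any measurable
  detector is a genuine (finite) expectation.\<close>

definition rate :: "nat \<Rightarrow> nat \<Rightarrow> int \<Rightarrow> ('w \<Rightarrow> complex vec) \<Rightarrow> real" where
  "rate p k n a = expectation (\<lambda>\<omega>. log 2 (1 + sinr p k n (a \<omega>) \<omega>))"

definition mrc_rate :: "nat \<Rightarrow> nat \<Rightarrow> int \<Rightarrow> real" where
  "mrc_rate p k n = rate p k n (predicted_channel p k n)"

end

end

theory Submission
  imports Defs "HOL-Real_Asymp.Real_Asymp"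
begin

text \<open>
  Let \<open>\<epsilon> = p_p\<close>, which tends to \<open>0\<close> like \<open>p_u\<close>. Since \<open>T = (1 / \<epsilon>) (1 + O(\<epsilon>))\<close>, to first order the filter
  \<open>q\<close> is \<open>\<epsilon> \<alpha> \<beta> \<delta>\<close>, so an entry of the predicted channel is \<open>\<surd>\<epsilon> Z + O(\<epsilon>)\<close> where
  \<open>Z = \<Sum>j\<le>p. \<alpha> \<beta> \<alpha>^j b[n - j]\<close> involves only the observation noise. The channels themselves
  enter only the error term, which is controlled by fourth moments and the Cauchy-Schwarz
  inequality; independence is needed for the noise alone. It gives the weak law
  \<open>\<Sum>m. \<bar>Z m\<bar>\<^sup>2 \<approx> M s\<close> with \<open>s = \<alpha>\<^sup>2 \<beta>\<^sup>2 \<Sum>j\<le>p. \<alpha>^(2 j)\<close> and makes the inner products between users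
  of order \<open>\<surd>M\<close>. Hence the SINR is close to \<open>p_u \<epsilon> M s = \<tau> p_u\<^sup>2 M s\<close> in \<open>L\<^sup>1\<close>, and the logarithm
  is Lipschitz.
\<close>

section \<open>Moments and orthogonality\<close>

text \<open>Every \<open>M\<close> comes with its own probability space, so there is no joint law in
  which random quantities could converge. All estimates are therefore non-asymptotic, at fixed
  \<open>M\<close> with constants free of \<open>M\<close>, and the limit is taken only among real
  numbers.

  The scale is set by \<open>p_u^2 * M\<close>, which converges to some \<open>\<kappa>\<close>;
  both claims are this one limit, with \<open>\<kappa> = E_u^2\<close> and
  \<open>\<kappa> = 0\<close>. The signal \<open>p_u * \<epsilon> * M * s\<close> stays bounded.
  Against it, the fluctuation of the squared norm costs a factor \<open>1 / sqrt M\<close>, the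
  channel contribution a factor \<open>sqrt \<epsilon>\<close>, and the prediction error in the
  denominator a factor \<open>p_u\<close>. Interference contributes
  \<open>p_u^2 * (\<epsilon>^2 * M + \<epsilon>^3 * M^2)\<close>: noise against noise gains from
  orthogonality, while everything else is allowed to grow like \<open>M^2\<close>, because it
  carries one more power of \<open>\<epsilon>\<close>.

  The random denominator does no harm: with MRC the norm of the detector cancels, and the quotient
  without interference is linear in the squared norm.\<close>

lemma sum_power4_le:
  fixes f :: "'a \<Rightarrow> real"
  shows "(\<Sum>i\<in>I. f i) ^ 4 \<le> real (card I) ^ 3 * (\<Sum>i\<in>I. f i ^ 4)"
proof -
  have "(\<Sum>i\<in>I. f i) ^ 4 = ((\<Sum>i\<in>I. f i)\<^sup>2)\<^sup>2"
    by (simp flip: power_mult)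
  also have "\<dots> \<le> ((\<Sum>i\<in>I. (f i)\<^sup>2) * card I)\<^sup>2"
    by (intro power_mono sum_squared_le_sum_of_squares) auto
  also have "\<dots> = (\<Sum>i\<in>I. (f i)\<^sup>2)\<^sup>2 * real (card I) ^ 2"
    by (simp add: power_mult_distrib)
  also have "\<dots> \<le> ((\<Sum>i\<in>I. ((f i)\<^sup>2)\<^sup>2) * card I) * real (card I) ^ 2"
    by (intro mult_right_mono sum_squared_le_sum_of_squares) auto
  also have "\<dots> = real (card I) ^ 3 * (\<Sum>i\<in>I. f i ^ 4)"
    by (simp add: power3_eq_cube power2_eq_square power4_eq_xxxx mult.assoc)
  finally show ?thesis .
qed

text \<open>Real and imaginary parts are independent centred Gaussians of variance
  \<open>v / 2\<close>, so the mean square is \<open>v / 2 + v / 2\<close>. Of the fourth moment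
  only finiteness is recorded: its value enters later merely as a constant that does not depend on
  the number of antennas.\<close>

lemma
  assumes "0 < v"
  shows integrable_complex_normal_power4: "integrable (complex_normal v) (\<lambda>z. cmod z ^ 4)"
    and integral_complex_normal: "(\<integral>z. z \<partial>complex_normal v) = 0"
    and integral_complex_normal_square: "(\<integral>z. (cmod z)\<^sup>2 \<partial>complex_normal v) = v"
proof -
  define \<sigma> where "\<sigma> = sqrt (v / 2)"
  have \<sigma>: "0 < \<sigma>" and \<sigma>2: "\<sigma>\<^sup>2 = v / 2"
    using assms by (auto simp: \<sigma>_def)
  define N where "N = density lborel (normal_density 0 \<sigma>)"
  interpret N: prob_space N
    unfolding N_def by (rule prob_space_normal_density[OF \<sigma>])
  interpret P: pair_prob_space N N ..
  have N_sets [measurable_cong]: "sets N = sets borel"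
    by (simp add: N_def)
  let ?h = "\<lambda>(x, y). Complex x y"
  have eq: "complex_normal v = distr (N \<Otimes>\<^sub>M N) borel ?h"
    using assms by (simp add: complex_normal_def N_def \<sigma>_def)
  have "(\<lambda>z. complex_of_real (fst z) + \<i> * complex_of_real (snd z)) \<in> borel_measurable (N \<Otimes>\<^sub>M N)"
    by measurable
  then have meas [measurable]: "?h \<in> borel_measurable (N \<Otimes>\<^sub>M N)"
    by (simp add: case_prod_beta Complex_eq)
  have intN: "integrable N (\<lambda>x. x ^ j)" for j
    using integrable_normal_moment[OF \<sigma>, of 0 j]
    by (simp add: N_def integrable_density)
  have momN: "(\<integral>x. x \<partial>N) = 0" "(\<integral>x. x\<^sup>2 \<partial>N) = v / 2"
    using integral_normal_moment_nz_1[OF \<sigma>, of 0] integral_normal_moment_even[OF \<sigma>, of 0 1] \<sigma>2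
    by (simp_all add: N_def integral_density numeral_2_eq_2)
  have fst_int: "integrable (N \<Otimes>\<^sub>M N) (\<lambda>z. fst z ^ j)"
    and fst_eq: "(\<integral>z. fst z ^ j \<partial>(N \<Otimes>\<^sub>M N)) = (\<integral>x. x ^ j \<partial>N)" for j
    using intN[of j] integrable_distr_eq[of fst "N \<Otimes>\<^sub>M N" N "\<lambda>x. x ^ j"]
      integral_distr[of fst "N \<Otimes>\<^sub>M N" N "\<lambda>x. x ^ j"]
    by (simp_all add: N.distr_pair_fst)
  have snd_distr: "distr (N \<Otimes>\<^sub>M N) N snd = N"
  proof -
    have "distr (N \<Otimes>\<^sub>M N) N snd = distr (distr (N \<Otimes>\<^sub>M N) (N \<Otimes>\<^sub>M N) (\<lambda>(x, y). (y, x))) N snd"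
      by (subst P.distr_pair_swap) simp
    also have "\<dots> = distr (N \<Otimes>\<^sub>M N) N fst"
      by (subst distr_distr) (auto simp: comp_def case_prod_beta)
    finally show ?thesis
      by (simp add: N.distr_pair_fst)
  qed
  have snd_int: "integrable (N \<Otimes>\<^sub>M N) (\<lambda>z. snd z ^ j)"
    and snd_eq: "(\<integral>z. snd z ^ j \<partial>(N \<Otimes>\<^sub>M N)) = (\<integral>x. x ^ j \<partial>N)" for j
    using intN[of j] integrable_distr_eq[of snd "N \<Otimes>\<^sub>M N" N "\<lambda>x. x ^ j"]
      integral_distr[of snd "N \<Otimes>\<^sub>M N" N "\<lambda>x. x ^ j"]
    by (simp_all add: snd_distr)
  have c2: "(cmod (?h z))\<^sup>2 = (fst z)\<^sup>2 + (snd z)\<^sup>2" for z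
    by (simp add: case_prod_beta cmod_def)
  have c4: "cmod (?h z) ^ 4 \<le> 2 * fst z ^ 4 + 2 * snd z ^ 4" for z
  proof -
    have "cmod (?h z) ^ 4 = ((fst z)\<^sup>2 + (snd z)\<^sup>2)\<^sup>2"
      unfolding c2[symmetric] by simp
    moreover have "0 \<le> ((fst z)\<^sup>2 - (snd z)\<^sup>2)\<^sup>2" by simp
    ultimately show ?thesis
      by (simp add: power2_eq_square power4_eq_xxxx algebra_simps)
  qed
  have "integrable (N \<Otimes>\<^sub>M N) (\<lambda>z. cmod (?h z) ^ 4)"
  proof (rule Bochner_Integration.integrable_bound)
    show "integrable (N \<Otimes>\<^sub>M N) (\<lambda>z. 2 * fst z ^ 4 + 2 * snd z ^ 4)"
      using fst_int snd_int by auto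
  qed (use c4 in \<open>auto intro!: AE_I2 order_trans[OF _ abs_ge_self]\<close>)
  then show "integrable (complex_normal v) (\<lambda>z. cmod z ^ 4)"
    unfolding eq by (subst integrable_distr_eq) auto
  show "(\<integral>z. (cmod z)\<^sup>2 \<partial>complex_normal v) = v"
    unfolding eq using fst_int[of 2] snd_int[of 2] fst_eq[of 2] snd_eq[of 2] momN(2)
    by (subst integral_distr) (auto simp: c2)
  have "(\<integral>z. z \<partial>complex_normal v) = (\<integral>z. complex_of_real (fst z) + \<i> * complex_of_real (snd z) \<partial>(N \<Otimes>\<^sub>M N))"
    unfolding eq by (subst integral_distr) (auto simp: case_prod_unfold Complex_eq)
  also have "\<dots> = 0"
    using fst_int[of 1] snd_int[of 1] fst_eq[of 1] snd_eq[of 1] momN(1)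
    by (subst Bochner_Integration.integral_add) auto
  finally show "(\<integral>z. z \<partial>complex_normal v) = 0" .
qed

context prob_space
begin

lemma integrable_of_square:
  fixes f :: "'a \<Rightarrow> complex"
  assumes [measurable]: "f \<in> borel_measurable M" and "integrable M (\<lambda>x. (cmod (f x))\<^sup>2)"
  shows "integrable M f"
proof (rule square_integrable_imp_integrable)
  show "integrable M (\<lambda>x. (f x)\<^sup>2)"
    by (rule Bochner_Integration.integrable_bound[OF assms(2)]) (auto simp: norm_power)
qed simp

lemma integrable_square_of_power4:
  assumes [measurable]: "f \<in> borel_measurable M" and "integrable M (\<lambda>x. (f x :: real) ^ 4)"
  shows "integrable M (\<lambda>x. (f x)\<^sup>2)"
proof (rule Bochner_Integration.integrable_bound)
  show "integrable M (\<lambda>x. 1 + f x ^ 4)"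
    using assms by auto
  have "t\<^sup>2 \<le> 1 + t ^ 4" for t :: real
  proof -
    have "0 \<le> (t\<^sup>2 - 1 / 2)\<^sup>2" by simp
    then show ?thesis by (simp add: power2_eq_square power4_eq_xxxx algebra_simps)
  qed
  then show "AE x in M. norm ((f x)\<^sup>2) \<le> norm (1 + f x ^ 4)"
    by auto
qed simp

text \<open>Independent centred variables are orthogonal for the Hermitian inner product: off the
  diagonal the expectation factorises into a product of means, each zero.\<close>

lemma expectation_mult_cnj_indep:
  fixes X :: "'i \<Rightarrow> 'a \<Rightarrow> complex"
  assumes indep: "indep_vars (\<lambda>_. borel) X I"
    and sq: "\<And>i. i \<in> I \<Longrightarrow> integrable M (\<lambda>x. (cmod (X i x))\<^sup>2)"
    and mean: "\<And>i. i \<in> I \<Longrightarrow> expectation (X i) = 0"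
    and ij: "i \<in> I" "j \<in> I"
  shows "integrable M (\<lambda>x. X i x * cnj (X j x))"
    and "expectation (\<lambda>x. X i x * cnj (X j x)) =
      (if i = j then of_real (expectation (\<lambda>x. (cmod (X i x))\<^sup>2)) else 0)"
proof -
  have meas: "X i \<in> borel_measurable M" if "i \<in> I" for i
    using indep that by (auto simp: indep_vars_def)
  have int: "integrable M (X i)" if "i \<in> I" for i
    by (rule integrable_of_square[OF meas sq]) (use that in auto)
  have diag: "X i x * cnj (X i x) = of_real ((cmod (X i x))\<^sup>2)" for i x
    using complex_norm_square by simp
  have "integrable M (\<lambda>x. X i x * cnj (X j x)) \<and>
      expectation (\<lambda>x. X i x * cnj (X j x)) =
        (if i = j then of_real (expectation (\<lambda>x. (cmod (X i x))\<^sup>2)) else 0)"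
  proof (cases "i = j")
    case True
    have "integrable M (\<lambda>x. complex_of_real ((cmod (X j x))\<^sup>2))"
      by (rule integrable_of_real) (rule sq[OF ij(2)])
    then show ?thesis
      using True by (simp add: diag del: of_real_power)
  next
    case False
    \<comment> \<open>The product rule for expectations wants both factors in one independent
      family. Only the factor at \<open>j\<close> is conjugated, so the map applied to
      \<open>X l\<close> depends on the index.\<close>
    have "indep_vars (\<lambda>_. borel) (\<lambda>l x. (if l = i then id else cnj) (X l x)) {i, j}"
    proof (rule indep_vars_compose2[where X = X and M' = "\<lambda>_. borel" and Y = "\<lambda>l. if l = i then id else cnj"])
      show "indep_vars (\<lambda>_. borel) X {i, j}"
        by (rule indep_vars_subset[OF indep]) (use ij in auto)
      show "(if l = i then id else cnj) \<in> borel_measurable borel" for l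
        by (auto simp: borel_measurable_continuous_onI continuous_on_cnj)
    qed
    note ind = this
    have "integrable M ((\<lambda>x. (if l = i then id else cnj) (X l x)))" if "l \<in> {i, j}" for l
      using int ij that by auto
    from indep_vars_lebesgue_integral[OF _ ind this] indep_vars_integrable[OF _ ind this]
    show ?thesis
      using False ij mean by simp
  qed
  then show "integrable M (\<lambda>x. X i x * cnj (X j x))"
    and "expectation (\<lambda>x. X i x * cnj (X j x)) =
      (if i = j then of_real (expectation (\<lambda>x. (cmod (X i x))\<^sup>2)) else 0)"
    by auto
qed

lemma expectation_norm_sum_square_indep:
  fixes X :: "'i \<Rightarrow> 'a \<Rightarrow> complex"
  assumes fin: "finite I" and indep: "indep_vars (\<lambda>_. borel) X I"
    and sq: "\<And>i. i \<in> I \<Longrightarrow> integrable M (\<lambda>x. (cmod (X i x))\<^sup>2)"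
    and mean: "\<And>i. i \<in> I \<Longrightarrow> expectation (X i) = 0"
  shows "integrable M (\<lambda>x. (cmod (\<Sum>i\<in>I. X i x))\<^sup>2)"
    and "expectation (\<lambda>x. (cmod (\<Sum>i\<in>I. X i x))\<^sup>2) = (\<Sum>i\<in>I. expectation (\<lambda>x. (cmod (X i x))\<^sup>2))"
proof -
  note cross = expectation_mult_cnj_indep[OF indep sq mean]
  \<comment> \<open>The cross terms are complex and vanish only as such, so the real second moment
    is computed inside the complex numbers and pulled back at the end.\<close>
  have expand: "complex_of_real ((cmod (\<Sum>i\<in>I. X i x))\<^sup>2) = (\<Sum>i\<in>I. \<Sum>j\<in>I. X i x * cnj (X j x))" for x
    by (simp only: complex_norm_square sum_product cnj_sum)
  have "integrable M (\<lambda>x. complex_of_real ((cmod (\<Sum>i\<in>I. X i x))\<^sup>2))"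
    unfolding expand using cross by (intro Bochner_Integration.integrable_sum) auto
  then show "integrable M (\<lambda>x. (cmod (\<Sum>i\<in>I. X i x))\<^sup>2)"
    by (simp only: complex_of_real_integrable_eq)
  have "complex_of_real (expectation (\<lambda>x. (cmod (\<Sum>i\<in>I. X i x))\<^sup>2))
      = expectation (\<lambda>x. \<Sum>i\<in>I. \<Sum>j\<in>I. X i x * cnj (X j x))"
    unfolding expand[symmetric] by (simp only: integral_complex_of_real)
  also have "\<dots> = (\<Sum>i\<in>I. \<Sum>j\<in>I. expectation (\<lambda>x. X i x * cnj (X j x)))"
    using cross by (subst Bochner_Integration.integral_sum; intro sum.cong refl Bochner_Integration.integral_sum
          Bochner_Integration.integrable_sum) auto
  also have "\<dots> = (\<Sum>i\<in>I. of_real (expectation (\<lambda>x. (cmod (X i x))\<^sup>2)))"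
    using cross fin by (simp add: sum.delta' cong: sum.cong)
  finally show "expectation (\<lambda>x. (cmod (\<Sum>i\<in>I. X i x))\<^sup>2) = (\<Sum>i\<in>I. expectation (\<lambda>x. (cmod (X i x))\<^sup>2))"
    by (simp only: of_real_sum[symmetric] of_real_eq_iff)
qed

text \<open>This is the nonnegativity of the variance of the absolute value. It turns the variance
  bound of the weak law into an \<open>L^1\<close> bound.\<close>

lemma expectation_abs_le_sqrt:
  fixes f :: "'a \<Rightarrow> real"
  assumes [measurable]: "f \<in> borel_measurable M" and sq: "integrable M (\<lambda>x. (f x)\<^sup>2)"
  shows "integrable M f" and "expectation (\<lambda>x. \<bar>f x\<bar>) \<le> sqrt (expectation (\<lambda>x. (f x)\<^sup>2))"
proof -
  show int: "integrable M f"
    using square_integrable_imp_integrable[OF _ sq] by simp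
  have "0 \<le> variance (\<lambda>x. \<bar>f x\<bar>)"
    by (rule variance_positive)
  also have "\<dots> = expectation (\<lambda>x. (f x)\<^sup>2) - (expectation (\<lambda>x. \<bar>f x\<bar>))\<^sup>2"
    using int sq by (subst variance_eq) auto
  finally show "expectation (\<lambda>x. \<bar>f x\<bar>) \<le> sqrt (expectation (\<lambda>x. (f x)\<^sup>2))"
    by (intro real_le_rsqrt) simp
qed

end

section \<open>The MRC rate for perturbed signals\<close>

text \<open>The derivative of \<open>ln\<close> is at most 1 on arguments from 1 on. An
  \<open>L^1\<close> estimate of the SINR thereby passes directly to the expected logarithm.\<close>

lemma log2_Lipschitz:
  fixes x y :: real
  assumes "0 \<le> x" "0 \<le> y"
  shows "\<bar>log 2 (1 + x) - log 2 (1 + y)\<bar> \<le> \<bar>x - y\<bar> / ln 2"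
proof -
  have *: "ln (1 + x) - ln (1 + y) \<le> \<bar>x - y\<bar>" if "0 \<le> x" "0 \<le> y" for x y :: real
  proof -
    have "ln (1 + x) - ln (1 + y) \<le> ((1 + x) - (1 + y)) / (1 + y)"
      using that by (intro ln_diff_le) auto
    also have "\<dots> \<le> \<bar>x - y\<bar> / 1"
      using that by (intro frac_le) auto
    finally show ?thesis by simp
  qed
  have "\<bar>ln (1 + x) - ln (1 + y)\<bar> \<le> \<bar>x - y\<bar>"
    using *[OF assms] *[OF assms(2,1)] by linarith
  then show ?thesis
    by (simp add: log_def divide_right_mono flip: diff_divide_distrib)
qed

text \<open>For MRC the useful signal is \<open>N^2\<close> and the detector has squared norm
  \<open>N\<close>, the squared norm of the prediction. Without interference (\<open>J = 0\<close>)
  and prediction error (\<open>d = 1\<close>) the SINR is exactly \<open>P * N\<close>. The bound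
  measures the effect of both disturbances.\<close>

lemma mrc_sinr_deviation:
  fixes P N J d :: real
  assumes "0 \<le> P" "0 \<le> N" "0 \<le> J" "\<bar>d - 1\<bar> \<le> 1 / 2"
  shows "\<bar>P * N\<^sup>2 / (P * J + N * d) - P * N\<bar> \<le> 2 * \<bar>d - 1\<bar> * (P * N) + 2 * P\<^sup>2 * J"
proof (cases "N = 0")
  case False
  then have N: "0 < N" using assms by simp
  have "N * (1 / 2) \<le> N * d"
    using N assms(4) by (intro mult_left_mono) (auto simp: abs_if split: if_splits)
  \<comment> \<open>Bounding the denominator below by a multiple of \<open>N\<close> makes
    \<open>N\<close> cancel in the interference term, so no lower bound on the random norm has to be
    proved.\<close>
  then have den: "N / 2 \<le> P * J + N * d"
    using mult_nonneg_nonneg[OF assms(1,3)] by simp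
  then have "0 < P * J + N * d" using N by linarith
  then have "P * N\<^sup>2 / (P * J + N * d) - P * N = - (P * N * (P * J + N * (d - 1)) / (P * J + N * d))"
    by (simp add: field_simps power2_eq_square)
  also have "\<bar>\<dots>\<bar> = P * N * \<bar>P * J + N * (d - 1)\<bar> / (P * J + N * d)"
    using \<open>0 < P * J + N * d\<close> assms by (simp add: abs_mult)
  also have "\<dots> \<le> P * N * (P * J + N * \<bar>d - 1\<bar>) / (N / 2)"
  proof (rule frac_le)
    show "P * N * \<bar>P * J + N * (d - 1)\<bar> \<le> P * N * (P * J + N * \<bar>d - 1\<bar>)"
      using assms abs_triangle_ineq[of "P * J" "N * (d - 1)"]
      by (intro mult_left_mono) (auto simp: abs_mult)
  qed (use assms N den in auto)
  also have "\<dots> = 2 * \<bar>d - 1\<bar> * (P * N) + 2 * P\<^sup>2 * J"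
    using N by (simp add: field_simps power2_eq_square)
  finally show ?thesis .
qed (use assms in simp)

text \<open>Both factors are \<open>sqrt \<epsilon>\<close> times a leading part plus an error of
  order \<open>\<epsilon>\<close>, so products agree to order
  \<open>\<epsilon> * sqrt \<epsilon>\<close>. A single majorant controls leading part and error
  together. The constant 3 is 2 from the error of \<open>x\<close> against the full
  \<open>y\<close>, plus 1 from the error of \<open>y\<close> against the leading part of
  \<open>x\<close>.\<close>

lemma perturbed_product_bound:
  fixes z w x y :: complex
  assumes "0 < \<epsilon>" "\<epsilon> \<le> 1" "cmod z \<le> h" "cmod w \<le> l"
    and "cmod (x - of_real (sqrt \<epsilon>) * z) \<le> \<epsilon> * h" "cmod (y - of_real (sqrt \<epsilon>) * w) \<le> \<epsilon> * l"
  shows "cmod y \<le> 2 * sqrt \<epsilon> * l"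
    and "cmod (x * cnj y - of_real \<epsilon> * (z * cnj w)) \<le> 3 * (\<epsilon> * sqrt \<epsilon>) * (h * l)"
proof -
  have e: "\<epsilon> \<le> sqrt \<epsilon>"
    using assms(1,2) by (simp add: real_le_rsqrt power2_eq_square mult_left_le_one_le)
  have nn: "0 \<le> h" "0 \<le> l"
    using assms(3,4) order_trans[OF norm_ge_zero] by blast+
  have "cmod y \<le> cmod (of_real (sqrt \<epsilon>) * w) + cmod (y - of_real (sqrt \<epsilon>) * w)"
    by (rule norm_triangle_sub)
  also have "\<dots> \<le> sqrt \<epsilon> * l + sqrt \<epsilon> * l"
    using assms e nn order_trans[OF assms(6) mult_right_mono[OF e nn(2)]]
    by (intro add_mono) (auto simp: norm_mult)
  finally show y: "cmod y \<le> 2 * sqrt \<epsilon> * l"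
    by (simp add: mult_ac)
  have "complex_of_real \<epsilon> = of_real (sqrt \<epsilon>) * of_real (sqrt \<epsilon>)"
    using assms(1) by (simp flip: of_real_mult)
  then have "x * cnj y - of_real \<epsilon> * (z * cnj w) =
      (x - of_real (sqrt \<epsilon>) * z) * cnj y + of_real (sqrt \<epsilon>) * z * cnj (y - of_real (sqrt \<epsilon>) * w)"
    by (simp add: algebra_simps)
  also have "cmod \<dots> \<le> cmod (x - of_real (sqrt \<epsilon>) * z) * cmod y + sqrt \<epsilon> * cmod z * cmod (y - of_real (sqrt \<epsilon>) * w)"
    using assms(1) by (intro order_trans[OF norm_triangle_ineq]) (simp add: norm_mult del: complex_cnj_diff)
  also have "\<dots> \<le> (\<epsilon> * h) * (2 * sqrt \<epsilon> * l) + sqrt \<epsilon> * h * (\<epsilon> * l)"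
    using assms nn y by (intro add_mono mult_mono) auto
  finally show "cmod (x * cnj y - of_real \<epsilon> * (z * cnj w)) \<le> 3 * (\<epsilon> * sqrt \<epsilon>) * (h * l)"
    by (simp add: algebra_simps)
qed

context prob_space
begin

text \<open>The probabilistic core, detached from the filter: \<open>G\<close> stands for the
  predicted channel entries, \<open>Z\<close> for their rescaled noise part, \<open>H\<close> for a
  common majorant, \<open>d\<close> for noise plus prediction error. The three summands of the bound
  come from the fluctuation of the squared norm of \<open>Z\<close>, from replacing \<open>G\<close>
  by \<open>Z\<close> together with \<open>d\<close> by 1, and from interference. \<open>V\<close>
  and \<open>W\<close> are the only places where cancellation between antennas enters; the rest is
  moment bounds.\<close>

lemma mrc_log_rate_bound:
  fixes Z G :: "nat \<Rightarrow> nat \<Rightarrow> 'a \<Rightarrow> complex" and H :: "nat \<Rightarrow> nat \<Rightarrow> 'a \<Rightarrow> real"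
  assumes U: "finite U" "k \<in> U" and P: "0 < P" and eps: "0 < \<epsilon>" "\<epsilon> \<le> 1" and d: "\<bar>d - 1\<bar> \<le> 1 / 2"
    and D: "1 \<le> D" and s: "0 \<le> s"
    and meas: "\<And>i m. i \<in> U \<Longrightarrow> m < L \<Longrightarrow> Z i m \<in> borel_measurable M"
      "\<And>i m. i \<in> U \<Longrightarrow> m < L \<Longrightarrow> G i m \<in> borel_measurable M"
      "\<And>i m. i \<in> U \<Longrightarrow> m < L \<Longrightarrow> H i m \<in> borel_measurable M"
    and Z_le: "\<And>i m x. i \<in> U \<Longrightarrow> m < L \<Longrightarrow> cmod (Z i m x) \<le> H i m x"
    and G_Z: "\<And>i m x. i \<in> U \<Longrightarrow> m < L \<Longrightarrow> cmod (G i m x - of_real (sqrt \<epsilon>) * Z i m x) \<le> \<epsilon> * H i m x"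
    and H4: "\<And>i m. i \<in> U \<Longrightarrow> m < L \<Longrightarrow> integrable M (\<lambda>x. H i m x ^ 4)"
      "\<And>i m. i \<in> U \<Longrightarrow> m < L \<Longrightarrow> expectation (\<lambda>x. H i m x ^ 4) \<le> D"
    and V: "integrable M (\<lambda>x. (\<Sum>m<L. (cmod (Z k m x))\<^sup>2 - s)\<^sup>2)"
      "expectation (\<lambda>x. (\<Sum>m<L. (cmod (Z k m x))\<^sup>2 - s)\<^sup>2) \<le> real L * D"
    and W: "\<And>i. i \<in> U - {k} \<Longrightarrow> integrable M (\<lambda>x. (cmod (\<Sum>m<L. Z i m x * cnj (Z k m x)))\<^sup>2)"
      "\<And>i. i \<in> U - {k} \<Longrightarrow> expectation (\<lambda>x. (cmod (\<Sum>m<L. Z i m x * cnj (Z k m x)))\<^sup>2) \<le> real L * D"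
  defines "S \<equiv> \<lambda>x. P * (cmod (\<Sum>m<L. G k m x * cnj (G k m x)))\<^sup>2 /
      (P * (\<Sum>i\<in>U - {k}. (cmod (\<Sum>m<L. G i m x * cnj (G k m x)))\<^sup>2) + (\<Sum>m<L. (cmod (G k m x))\<^sup>2) * d)"
  shows "\<bar>expectation (\<lambda>x. log 2 (1 + S x)) - log 2 (1 + P * \<epsilon> * real L * s)\<bar> \<le>
    (P * \<epsilon> * sqrt (real L * D) + (3 * sqrt \<epsilon> + 8 * \<bar>d - 1\<bar>) * (P * \<epsilon> * (real L * D))
     + 2 * P\<^sup>2 * (real (card U) * (2 * \<epsilon>\<^sup>2 * (real L * D) + 18 * \<epsilon> ^ 3 * real L * (real L * D)))) / ln 2"
proof -
  define V' where "V' x = (\<Sum>m<L. (cmod (Z k m x))\<^sup>2 - s)" for x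
  define Q where "Q x = (\<Sum>m<L. (H k m x)\<^sup>2)" for x
  define W' where "W' i x = (\<Sum>m<L. Z i m x * cnj (Z k m x))" for i x
  define Y where "Y i x = (\<Sum>m<L. (H i m x)\<^sup>2 * (H k m x)\<^sup>2)" for i x
  define N where "N x = (\<Sum>m<L. (cmod (G k m x))\<^sup>2)" for x
  define C where "C i x = (\<Sum>m<L. G i m x * cnj (G k m x))" for i x
  define J where "J x = (\<Sum>i\<in>U - {k}. (cmod (C i x))\<^sup>2)" for x
  \<comment> \<open>A pointwise majorant of the SINR error, shaped so that integrating it term by
    term gives the stated bound.\<close>
  define B where "B x = P * \<epsilon> * \<bar>V' x\<bar> + (3 * sqrt \<epsilon> + 8 * \<bar>d - 1\<bar>) * (P * \<epsilon> * Q x)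
     + 2 * P\<^sup>2 * (\<Sum>i\<in>U - {k}. 2 * \<epsilon>\<^sup>2 * (cmod (W' i x))\<^sup>2 + 18 * \<epsilon> ^ 3 * real L * Y i x)" for x
  define c where "c = P * \<epsilon> * real L * s"
  note [measurable] = meas
  have Q_nn: "0 \<le> Q x" for x
    unfolding Q_def by (intro sum_nonneg) auto
  have N_nn: "0 \<le> N x" and J_nn: "0 \<le> J x" for x
    unfolding N_def J_def by (intro sum_nonneg; auto)+
  have c_nn: "0 \<le> c"
    using P eps s by (auto simp: c_def)
  have Ckk: "cmod (C k x) = N x" for x
  proof -
    have "C k x = of_real (N x)"
      by (simp add: C_def N_def complex_norm_square[symmetric])
    then show ?thesis
      using N_nn by simp
  qed
  have S_eq: "S x = P * (N x)\<^sup>2 / (P * J x + N x * d)" for x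
    unfolding S_def by (simp add: C_def[symmetric] Ckk J_def N_def)
  have d_nn: "0 \<le> d"
    using d by (simp add: abs_if split: if_splits)
  have S_nn: "0 \<le> S x" for x
    unfolding S_eq using P N_nn J_nn d_nn
    by (intro divide_nonneg_nonneg add_nonneg_nonneg mult_nonneg_nonneg) auto
  have N_dev: "\<bar>N x - \<epsilon> * (V' x + real L * s)\<bar> \<le> 3 * (\<epsilon> * sqrt \<epsilon>) * Q x"
    and N_le: "N x \<le> 4 * \<epsilon> * Q x" for x
  proof -
    have "N x - \<epsilon> * (V' x + real L * s) = (\<Sum>m<L. (cmod (G k m x))\<^sup>2 - \<epsilon> * (cmod (Z k m x))\<^sup>2)"
      by (simp add: N_def V'_def sum_subtractf sum_distrib_left)
    also have "\<bar>\<dots>\<bar> \<le> (\<Sum>m<L. 3 * (\<epsilon> * sqrt \<epsilon>) * (H k m x)\<^sup>2)"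
    proof (rule order_trans[OF sum_abs], rule sum_mono)
      fix m assume "m \<in> {..<L}"
      \<comment> \<open>The diagonal case \<open>x = y\<close>, \<open>z = w\<close> of the product
        bound, where the products are squared moduli.\<close>
      then have "cmod (G k m x * cnj (G k m x) - of_real \<epsilon> * (Z k m x * cnj (Z k m x))) \<le>
        3 * (\<epsilon> * sqrt \<epsilon>) * (H k m x * H k m x)"
        using U by (intro perturbed_product_bound(2) eps Z_le G_Z) auto
      then show "\<bar>(cmod (G k m x))\<^sup>2 - \<epsilon> * (cmod (Z k m x))\<^sup>2\<bar> \<le> 3 * (\<epsilon> * sqrt \<epsilon>) * (H k m x)\<^sup>2"
        by (simp only: complex_norm_square[symmetric] of_real_mult[symmetric] of_real_diff[symmetric]
            norm_of_real power2_eq_square)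
    qed
    finally show "\<bar>N x - \<epsilon> * (V' x + real L * s)\<bar> \<le> 3 * (\<epsilon> * sqrt \<epsilon>) * Q x"
      by (simp add: Q_def sum_distrib_left)
    have "N x \<le> (\<Sum>m<L. 4 * \<epsilon> * (H k m x)\<^sup>2)"
      unfolding N_def
    proof (rule sum_mono)
      fix m assume "m \<in> {..<L}"
      then have "cmod (G k m x) \<le> 2 * sqrt \<epsilon> * H k m x"
        using U by (intro perturbed_product_bound(1)[where x = "G k m x" and z = "Z k m x" and h = "H k m x" and w = "Z k m x"] eps Z_le G_Z) auto
      then have "(cmod (G k m x))\<^sup>2 \<le> (2 * sqrt \<epsilon> * H k m x)\<^sup>2"
        by (intro power_mono) auto
      then show "(cmod (G k m x))\<^sup>2 \<le> 4 * \<epsilon> * (H k m x)\<^sup>2"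
        using eps by (simp add: power_mult_distrib)
    qed
    then show "N x \<le> 4 * \<epsilon> * Q x"
      by (simp add: Q_def sum_distrib_left)
  qed
  have C_le: "(cmod (C i x))\<^sup>2 \<le> 2 * \<epsilon>\<^sup>2 * (cmod (W' i x))\<^sup>2 + 18 * \<epsilon> ^ 3 * real L * Y i x" if "i \<in> U" for i x
  proof -
    define r where "r = (\<Sum>m<L. H i m x * H k m x)"
    have "C i x - of_real \<epsilon> * W' i x = (\<Sum>m<L. G i m x * cnj (G k m x) - of_real \<epsilon> * (Z i m x * cnj (Z k m x)))"
      by (simp add: C_def W'_def sum_subtractf sum_distrib_left)
    also have "cmod \<dots> \<le> (\<Sum>m<L. 3 * (\<epsilon> * sqrt \<epsilon>) * (H i m x * H k m x))"
      using U that by (intro sum_norm_le perturbed_product_bound(2) eps Z_le G_Z) auto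
    also have "\<dots> = 3 * (\<epsilon> * sqrt \<epsilon>) * r"
      by (simp add: r_def sum_distrib_left)
    finally have 1: "cmod (C i x - of_real \<epsilon> * W' i x) \<le> 3 * (\<epsilon> * sqrt \<epsilon>) * r" .
    have "cmod (C i x) \<le> cmod (of_real \<epsilon> * W' i x) + cmod (C i x - of_real \<epsilon> * W' i x)"
      by (rule norm_triangle_sub)
    then have "cmod (C i x) \<le> \<epsilon> * cmod (W' i x) + 3 * (\<epsilon> * sqrt \<epsilon>) * r"
      using 1 eps by (simp add: norm_mult)
    then have "(cmod (C i x))\<^sup>2 \<le> (\<epsilon> * cmod (W' i x) + 3 * (\<epsilon> * sqrt \<epsilon>) * r)\<^sup>2"
      by (intro power_mono) auto
    also have "\<dots> \<le> 2 * (\<epsilon> * cmod (W' i x))\<^sup>2 + 2 * (3 * (\<epsilon> * sqrt \<epsilon>) * r)\<^sup>2"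
      using sum_squares_bound[of "\<epsilon> * cmod (W' i x)" "3 * (\<epsilon> * sqrt \<epsilon>) * r"] by (simp add: power2_sum)
    also have "\<dots> = 2 * \<epsilon>\<^sup>2 * (cmod (W' i x))\<^sup>2 + 18 * \<epsilon> ^ 3 * r\<^sup>2"
      using eps by (simp add: power_mult_distrib power3_eq_cube power2_eq_square)
    \<comment> \<open>Cauchy-Schwarz over the antennas costs a factor \<open>L\<close> here, since
      nothing is known about cancellation among these error terms. The power
      \<open>\<epsilon> ^ 3\<close> pays for it.\<close>
    also have "\<dots> \<le> 2 * \<epsilon>\<^sup>2 * (cmod (W' i x))\<^sup>2 + 18 * \<epsilon> ^ 3 * (real L * Y i x)"
      using eps sum_squared_le_sum_of_squares[of "\<lambda>m. H i m x * H k m x" "{..<L}"]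
      by (intro add_mono mult_left_mono) (auto simp: r_def Y_def power_mult_distrib mult.commute)
    finally show ?thesis by simp
  qed
  \<comment> \<open>Two replacements: the SINR by \<open>P * N\<close>, then \<open>N\<close> by
    \<open>\<epsilon> * real L * s\<close>.\<close>
  have dev: "\<bar>S x - c\<bar> \<le> B x" for x
  proof -
    have a: "\<bar>S x - P * N x\<bar> \<le> 2 * \<bar>d - 1\<bar> * (P * N x) + 2 * P\<^sup>2 * J x"
      unfolding S_eq by (rule mrc_sinr_deviation) (use P N_nn J_nn d in auto)
    have b: "2 * \<bar>d - 1\<bar> * (P * N x) \<le> 2 * \<bar>d - 1\<bar> * (P * (4 * \<epsilon> * Q x))"
      using P N_le by (intro mult_left_mono) auto
    have "J x \<le> (\<Sum>i\<in>U - {k}. 2 * \<epsilon>\<^sup>2 * (cmod (W' i x))\<^sup>2 + 18 * \<epsilon> ^ 3 * real L * Y i x)"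
      unfolding J_def using C_le by (intro sum_mono) auto
    then have e: "2 * P\<^sup>2 * J x \<le> 2 * P\<^sup>2 * (\<Sum>i\<in>U - {k}. 2 * \<epsilon>\<^sup>2 * (cmod (W' i x))\<^sup>2 + 18 * \<epsilon> ^ 3 * real L * Y i x)"
      by (intro mult_left_mono) auto
    have "P * N x - c = P * ((N x - \<epsilon> * (V' x + real L * s)) + \<epsilon> * V' x)"
      by (simp add: c_def algebra_simps)
    then have "\<bar>P * N x - c\<bar> = P * \<bar>(N x - \<epsilon> * (V' x + real L * s)) + \<epsilon> * V' x\<bar>"
      using P by (simp only: abs_mult abs_of_pos)
    also have "\<dots> \<le> P * (3 * (\<epsilon> * sqrt \<epsilon>) * Q x + \<epsilon> * \<bar>V' x\<bar>)"
      using P eps N_dev[of x] by (intro mult_left_mono order_trans[OF abs_triangle_ineq] add_mono) (auto simp: abs_mult)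
    finally have f: "\<bar>P * N x - c\<bar> \<le> P * \<epsilon> * \<bar>V' x\<bar> + 3 * sqrt \<epsilon> * (P * \<epsilon> * Q x)"
      by (simp add: algebra_simps)
    \<comment> \<open>The 8 is the 2 of the SINR deviation times the 4 in
      \<open>N x \<le> 4 * \<epsilon> * Q x\<close>.\<close>
    have g: "(3 * sqrt \<epsilon> + 8 * \<bar>d - 1\<bar>) * (P * \<epsilon> * Q x) = 3 * sqrt \<epsilon> * (P * \<epsilon> * Q x) + 2 * \<bar>d - 1\<bar> * (P * (4 * \<epsilon> * Q x))"
      by (simp add: algebra_simps)
    show ?thesis
      unfolding B_def g using a b e f by linarith
  qed
  \<comment> \<open>Arithmetic-geometric mean inequalities reduce all moments to fourth ones. The
    first compares with the constant 1, which is absorbed through \<open>1 \<le> D\<close>.\<close>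
  have four: "t\<^sup>2 \<le> (1 + t ^ 4) / 2" "t\<^sup>2 * u\<^sup>2 \<le> (t ^ 4 + u ^ 4) / 2" for t u :: real
    using sum_squares_bound[of "t\<^sup>2" 1] sum_squares_bound[of "t\<^sup>2" "u\<^sup>2"] by (simp_all flip: power_mult)
  have H2: "integrable M (\<lambda>x. (H i m x)\<^sup>2)" "expectation (\<lambda>x. (H i m x)\<^sup>2) \<le> D"
    if im: "i \<in> U" "m < L" for i m
  proof -
    note [simp] = H4(1)[OF im]
    show 1: "integrable M (\<lambda>x. (H i m x)\<^sup>2)"
      by (rule integrable_square_of_power4[OF meas(3)[OF im]]) simp
    have "expectation (\<lambda>x. (H i m x)\<^sup>2) \<le> expectation (\<lambda>x. (1 + H i m x ^ 4) / 2)"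
      using 1 four(1) by (intro integral_mono) auto
    also have "\<dots> \<le> D"
      using H4(2)[OF im] D by (simp add: prob_space)
    finally show "expectation (\<lambda>x. (H i m x)\<^sup>2) \<le> D" .
  qed
  have HH: "integrable M (\<lambda>x. (H i m x)\<^sup>2 * (H k m x)\<^sup>2)" "expectation (\<lambda>x. (H i m x)\<^sup>2 * (H k m x)\<^sup>2) \<le> D"
    if im: "i \<in> U" "m < L" for i m
  proof -
    note [simp] = H4(1)[OF im] H4(1)[OF U(2) im(2)]
    note [measurable] = meas(3)[OF im] meas(3)[OF U(2) im(2)]
    have int: "integrable M (\<lambda>x. (H i m x ^ 4 + H k m x ^ 4) / 2)" by simp
    show 1: "integrable M (\<lambda>x. (H i m x)\<^sup>2 * (H k m x)\<^sup>2)"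
      by (rule Bochner_Integration.integrable_bound[OF int]) (use four(2) in \<open>auto intro!: AE_I2 order_trans[OF _ abs_ge_self]\<close>)
    have "expectation (\<lambda>x. (H i m x)\<^sup>2 * (H k m x)\<^sup>2) \<le> expectation (\<lambda>x. (H i m x ^ 4 + H k m x ^ 4) / 2)"
      using 1 int four(2) by (intro integral_mono) auto
    also have "\<dots> \<le> D"
      using H4(2)[OF im] H4(2)[OF U(2) im(2)] by simp
    finally show "expectation (\<lambda>x. (H i m x)\<^sup>2 * (H k m x)\<^sup>2) \<le> D" .
  qed
  have V'_meas: "V' \<in> borel_measurable M"
    unfolding V'_def using meas(1)[OF U(2)] by (intro borel_measurable_sum) auto
  note V' = expectation_abs_le_sqrt[OF V'_meas, unfolded V'_def, OF V(1), folded V'_def]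
  have EV: "expectation (\<lambda>x. \<bar>V' x\<bar>) \<le> sqrt (real L * D)"
    using V'(2) V(2) by (auto simp: V'_def intro: order_trans real_sqrt_le_mono)
  have IQ: "integrable M Q" and EQ: "expectation Q \<le> real L * D"
  proof -
    show "integrable M Q"
      unfolding Q_def using H2 U by (intro Bochner_Integration.integrable_sum) auto
    have "expectation Q = (\<Sum>m<L. expectation (\<lambda>x. (H k m x)\<^sup>2))"
      unfolding Q_def using H2 U by (intro Bochner_Integration.integral_sum) auto
    also have "\<dots> \<le> real (card {..<L}) * D"
      using H2 U by (intro sum_bounded_above) auto
    finally show "expectation Q \<le> real L * D" by simp
  qed
  have IY: "integrable M (Y i)" and EY: "expectation (Y i) \<le> real L * D" if "i \<in> U" for i
  proof -
    show "integrable M (Y i)"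
      unfolding Y_def using HH that by (intro Bochner_Integration.integrable_sum) auto
    have "expectation (Y i) = (\<Sum>m<L. expectation (\<lambda>x. (H i m x)\<^sup>2 * (H k m x)\<^sup>2))"
      unfolding Y_def using HH that by (intro Bochner_Integration.integral_sum) auto
    also have "\<dots> \<le> real (card {..<L}) * D"
      using HH that by (intro sum_bounded_above) auto
    finally show "expectation (Y i) \<le> real L * D" by simp
  qed
  note W = W[folded W'_def]
  have hB: "has_bochner_integral M B (P * \<epsilon> * expectation (\<lambda>x. \<bar>V' x\<bar>) + (3 * sqrt \<epsilon> + 8 * \<bar>d - 1\<bar>) * (P * \<epsilon> * expectation Q)
     + 2 * P\<^sup>2 * (\<Sum>i\<in>U - {k}. 2 * \<epsilon>\<^sup>2 * expectation (\<lambda>x. (cmod (W' i x))\<^sup>2) + 18 * \<epsilon> ^ 3 * real L * expectation (Y i)))"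
    unfolding B_def [abs_def]
    by (intro has_bochner_integral_add has_bochner_integral_sum has_bochner_integral_mult_right has_bochner_integral_integrable) (use V'(1) IQ IY W(1) in auto)
  then have IB: "integrable M B"
    by (rule integrable.intros)
  from hB have "expectation B = P * \<epsilon> * expectation (\<lambda>x. \<bar>V' x\<bar>) + (3 * sqrt \<epsilon> + 8 * \<bar>d - 1\<bar>) * (P * \<epsilon> * expectation Q)
     + 2 * P\<^sup>2 * (\<Sum>i\<in>U - {k}. 2 * \<epsilon>\<^sup>2 * expectation (\<lambda>x. (cmod (W' i x))\<^sup>2) + 18 * \<epsilon> ^ 3 * real L * expectation (Y i))"
    by (rule has_bochner_integral_integral_eq)
  also have "\<dots> \<le> P * \<epsilon> * sqrt (real L * D) + (3 * sqrt \<epsilon> + 8 * \<bar>d - 1\<bar>) * (P * \<epsilon> * (real L * D))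
     + 2 * P\<^sup>2 * (real (card (U - {k})) * (2 * \<epsilon>\<^sup>2 * (real L * D) + 18 * \<epsilon> ^ 3 * real L * (real L * D)))"
    using P eps EV EQ EY W(2) by (intro add_mono mult_left_mono sum_bounded_above) auto
  also have "\<dots> \<le> P * \<epsilon> * sqrt (real L * D) + (3 * sqrt \<epsilon> + 8 * \<bar>d - 1\<bar>) * (P * \<epsilon> * (real L * D))
     + 2 * P\<^sup>2 * (real (card U) * (2 * \<epsilon>\<^sup>2 * (real L * D) + 18 * \<epsilon> ^ 3 * real L * (real L * D)))"
    using P eps D U by (intro add_mono mult_left_mono mult_right_mono) (auto intro: card_mono)
  finally have EB: "expectation B \<le> \<dots>" .
  have S_meas [measurable]: "S \<in> borel_measurable M"
  proof -
    have C_meas [measurable]: "C i \<in> borel_measurable M" if "i \<in> U" for i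
    proof -
      have "(\<lambda>x. G i m x * cnj (G k m x)) \<in> borel_measurable M" if "m < L" for m
        using meas(2)[OF \<open>i \<in> U\<close> that] meas(2)[OF U(2) that]
        by (intro borel_measurable_times measurable_compose[OF _ borel_measurable_continuous_onI[of cnj]]) (auto intro: continuous_on_cnj)
      then show ?thesis
        unfolding C_def by (intro borel_measurable_sum) auto
    qed
    have N_meas [measurable]: "N \<in> borel_measurable M"
      unfolding N_def using meas(2)[OF U(2)] by (intro borel_measurable_sum) auto
    have J_meas [measurable]: "J \<in> borel_measurable M"
      unfolding J_def by (intro borel_measurable_sum) auto
    show ?thesis
      unfolding S_eq by measurable
  qed
  \<comment> \<open>Integrability of the SINR itself also comes from the pointwise majorant.\<close>
  have IS: "integrable M (\<lambda>x. S x - c)"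
    by (rule Bochner_Integration.integrable_bound[OF IB]) (use dev in \<open>auto intro!: AE_I2 order_trans[OF _ abs_ge_self]\<close>)
  have Llog: "\<bar>log 2 (1 + S x) - log 2 (1 + c)\<bar> \<le> \<bar>S x - c\<bar> / ln 2" for x
    by (rule log2_Lipschitz[OF S_nn c_nn])
  have IL: "integrable M (\<lambda>x. log 2 (1 + S x) - log 2 (1 + c))"
    by (rule Bochner_Integration.integrable_bound[of _ "\<lambda>x. (S x - c) / ln 2"]) (use IS Llog in auto)
  then have "integrable M (\<lambda>x. (log 2 (1 + S x) - log 2 (1 + c)) + log 2 (1 + c))"
    by (intro Bochner_Integration.integrable_add) auto
  then have "expectation (\<lambda>x. log 2 (1 + S x)) - log 2 (1 + c) = expectation (\<lambda>x. log 2 (1 + S x) - log 2 (1 + c))"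
    by (simp add: prob_space)
  also have "\<bar>\<dots>\<bar> \<le> expectation (\<lambda>x. \<bar>log 2 (1 + S x) - log 2 (1 + c)\<bar>)"
    by (rule integral_abs_bound)
  also have "\<dots> \<le> expectation (\<lambda>x. B x / ln 2)"
    using IL IB by (intro integral_mono order_trans[OF Llog] divide_right_mono dev) auto
  also have "\<dots> = expectation B / ln 2"
    by simp
  also have "\<dots> \<le> (P * \<epsilon> * sqrt (real L * D) + (3 * sqrt \<epsilon> + 8 * \<bar>d - 1\<bar>) * (P * \<epsilon> * (real L * D))
     + 2 * P\<^sup>2 * (real (card U) * (2 * \<epsilon>\<^sup>2 * (real L * D) + 18 * \<epsilon> ^ 3 * real L * (real L * D)))) / ln 2"
    using EB by (intro divide_right_mono) auto
  finally show ?thesis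
    unfolding c_def .
qed

end

section \<open>The prediction filter at low power\<close>

text \<open>A stacked index is \<open>j * M + m\<close> with time lag \<open>j\<close> and antenna
  \<open>m\<close>; this separates the two.\<close>

lemma sum_div_mod:
  fixes f :: "nat \<Rightarrow> nat \<Rightarrow> 'b::comm_monoid_add"
  assumes "0 < M"
  shows "(\<Sum>s<n * M. f (s div M) (s mod M)) = (\<Sum>j<n. \<Sum>m<M. f j m)"
proof -
  have "(\<Sum>s<n * M. f (s div M) (s mod M)) = (\<Sum>j<n. \<Sum>s\<in>{j * M..<j * M + M}. f (s div M) (s mod M))"
    by (rule sum.nat_group[symmetric])
  also have "\<dots> = (\<Sum>j<n. \<Sum>m<M. f j m)"
  proof (rule sum.cong[OF refl])
    fix j
    have "(\<Sum>s\<in>{j * M..<j * M + M}. f (s div M) (s mod M)) = (\<Sum>m\<in>{0..<M}. f ((m + j * M) div M) ((m + j * M) mod M))"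
      using sum.shift_bounds_nat_ivl[of "\<lambda>s. f (s div M) (s mod M)" 0 "j * M" M] by (simp add: add.commute)
    also have "\<dots> = (\<Sum>m<M. f j m)"
      by (rule sum.cong) auto
    finally show "(\<Sum>s\<in>{j * M..<j * M + M}. f (s div M) (s mod M)) = (\<Sum>m<M. f j m)" .
  qed
  finally show ?thesis .
qed

lemma block_index_less:
  fixes j p m M :: nat
  assumes "j < p + 1" "m < M"
  shows "j * M + m < (p + 1) * M"
proof -
  have "j * M + m < (j + 1) * M" using assms by simp
  also have "\<dots> \<le> (p + 1) * M" using assms by (intro mult_right_mono) auto
  finally show ?thesis .
qed

text \<open>A Neumann-series bound without the series: at an index where the norm is largest, the
  maximum \<open>m\<close> satisfies \<open>m \<le> a + m / 2\<close>.\<close>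

lemma sup_norm_contraction:
  fixes x :: "'a \<Rightarrow> 'b::real_normed_vector"
  assumes "finite S" "0 \<le> a" "0 \<le> c" "c * real (card S) \<le> 1 / 2"
    and bound: "\<And>j. j \<in> S \<Longrightarrow> norm (x j) \<le> a + c * (\<Sum>i\<in>S. norm (x i))"
    and "j \<in> S"
  shows "norm (x j) \<le> 2 * a"
proof -
  define m where "m = Max ((\<lambda>i. norm (x i)) ` S)"
  have le: "norm (x i) \<le> m" if "i \<in> S" for i
    unfolding m_def using assms(1) that by (intro Max_ge) auto
  have "m \<in> (\<lambda>i. norm (x i)) ` S"
    unfolding m_def using assms(1,6) by (intro Max_in) auto
  then obtain i where i: "i \<in> S" "m = norm (x i)"
    by auto
  have "0 \<le> m"
    using i by simp
  have "m \<le> a + c * (\<Sum>i\<in>S. norm (x i))"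
    using bound[OF i(1)] i(2) by simp
  also have "(\<Sum>i\<in>S. norm (x i)) \<le> real (card S) * m"
    using sum_bounded_above[of S "\<lambda>i. norm (x i)" m] le by simp
  then have "a + c * (\<Sum>i\<in>S. norm (x i)) \<le> a + c * real (card S) * m"
    using assms(3) by (simp add: mult.assoc mult_left_mono)
  also have "\<dots> \<le> a + 1 / 2 * m"
    using mult_right_mono[OF assms(4) \<open>0 \<le> m\<close>] by simp
  finally have "m \<le> 2 * a"
    by simp
  then show ?thesis
    using le[OF assms(6)] by simp
qed

lemma conjugate_scalar_prod_eq_sum:
  fixes v w :: "complex vec"
  assumes "dim_vec v = L" "dim_vec w = L"
  shows "v \<bullet>c w = (\<Sum>m<L. v $ m * cnj (w $ m))"
  using assms by (auto simp: scalar_prod_def atLeast0LessThan intro!: sum.cong)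

context uplink
begin

lemma antennas_pos: "k \<in> {1..K} \<Longrightarrow> 0 < M"
  using users_le_antennas by auto

lemma p_p_pos: "k \<in> {1..K} \<Longrightarrow> 0 < p_p"
  using training_length power_pos by (auto simp: p_p_def)

lemma abs_alpha_power_le: "\<bar>\<alpha> ^ j\<bar> \<le> 1"
  using alpha_bound by (simp add: power_abs power_le_one)

section \<open>The observation covariance \<open>T\<close> and its inverse\<close>

lemma index_delta_kronecker:
  assumes "m < M" "s < (p + 1) * M"
  shows "(\<delta> p \<otimes>\<^sub>K 1\<^sub>m M) $$ (m, s) = (if s mod M = m then of_real (\<alpha> ^ (s div M)) else 0)"
proof -
  have "s div M < p + 1"
    using assms by (simp add: less_mult_imp_div_less)
  then show ?thesis
    using assms by (auto simp: kronecker_def \<delta>_def)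
qed

lemma T_carrier: "T p k \<in> carrier_mat ((p + 1) * M) ((p + 1) * M)"
  by (auto simp: T_def kronecker_def \<Delta>_def mult.commute)

lemma index_T:
  assumes "r < (p + 1) * M" "s < (p + 1) * M"
  shows "T p k $$ (r, s) =
    (if r mod M = s mod M then of_real (\<beta> k * \<alpha> ^ nat \<bar>int (r div M) - int (s div M)\<bar>) else 0) +
    (if r = s then of_real (1 / p_p) else 0)"
proof -
  have "r div M < p + 1" "s div M < p + 1"
    using assms by (simp_all add: less_mult_imp_div_less)
  moreover have "0 < M"
    using assms by (cases M) auto
  ultimately show ?thesis
    using assms by (auto simp: T_def kronecker_def \<Delta>_def mult.commute[of M])
qed

text \<open>\<open>T\<close> couples only stacked indices with the same residue modulo
  \<open>M\<close>, that is, the same antenna. Every antenna thus carries its own copy of one system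
  of size \<open>p + 1\<close>, whatever \<open>M\<close> is. The first form serves the kernel of
  \<open>T\<close>, the second the product of \<open>q\<close> with \<open>T\<close>.\<close>

lemma sum_T_class:
  fixes x :: "nat \<Rightarrow> complex"
  assumes "j < p + 1" "m < M"
  shows "(\<Sum>s<(p + 1) * M. T p k $$ (j * M + m, s) * x s) =
     of_real (\<beta> k) * (\<Sum>i<p + 1. of_real (\<alpha> ^ nat \<bar>int j - int i\<bar>) * x (i * M + m))
     + of_real (1 / p_p) * x (j * M + m)"
    and "(\<Sum>s<(p + 1) * M. x s * T p k $$ (s, j * M + m)) =
     of_real (\<beta> k) * (\<Sum>i<p + 1. of_real (\<alpha> ^ nat \<bar>int j - int i\<bar>) * x (i * M + m))
     + of_real (1 / p_p) * x (j * M + m)"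
proof -
  have r: "j * M + m < (p + 1) * M"
    by (rule block_index_less[OF assms])
  have M: "0 < M" using assms by simp
  have *: "(j * M + m) div M = j" "(j * M + m) mod M = m"
    using assms by auto
  \<comment> \<open>Writing \<open>x s\<close> through \<open>s div M\<close> and
    \<open>s mod M\<close> puts the summand into the shape that \<open>sum_div_mod\<close>
    expects.\<close>
  have "(\<Sum>s<(p + 1) * M. T p k $$ (j * M + m, s) * x s) =
    (\<Sum>s<(p + 1) * M. (if m = s mod M then of_real (\<beta> k * \<alpha> ^ nat \<bar>int j - int (s div M)\<bar>) * x (s div M * M + s mod M) else 0)
      + (if s = j * M + m then of_real (1 / p_p) * x s else 0))"
  proof (rule sum.cong[OF refl])
    fix s assume "s \<in> {..<(p + 1) * M}"
    then have s: "s < (p + 1) * M" by simp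
    show "T p k $$ (j * M + m, s) * x s =
      (if m = s mod M then of_real (\<beta> k * \<alpha> ^ nat \<bar>int j - int (s div M)\<bar>) * x (s div M * M + s mod M) else 0)
      + (if s = j * M + m then of_real (1 / p_p) * x s else 0)"
      unfolding index_T[OF r s] * div_mult_mod_eq distrib_right
      by (intro arg_cong2[where f = "(+)"]) auto
  qed
  also have "\<dots> = (\<Sum>i<p + 1. \<Sum>m'<M. if m = m' then of_real (\<beta> k * \<alpha> ^ nat \<bar>int j - int i\<bar>) * x (i * M + m') else 0)
      + of_real (1 / p_p) * x (j * M + m)"
    unfolding sum.distrib
    using r sum_div_mod[OF M, where n = "p + 1" and f = "\<lambda>a b. if m = b then of_real (\<beta> k * \<alpha> ^ nat \<bar>int j - int a\<bar>) * x (a * M + b) else 0"]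
    by simp
  also have "\<dots> = of_real (\<beta> k) * (\<Sum>i<p + 1. of_real (\<alpha> ^ nat \<bar>int j - int i\<bar>) * x (i * M + m))
     + of_real (1 / p_p) * x (j * M + m)"
    using assms(2) by (simp add: sum_distrib_left mult.assoc distrib_left)
  finally show 1: "(\<Sum>s<(p + 1) * M. T p k $$ (j * M + m, s) * x s) = \<dots>" .
  have "T p k $$ (s, j * M + m) = T p k $$ (j * M + m, s)" if "s < (p + 1) * M" for s
    using that r by (auto simp: index_T abs_minus_commute)
  then have "(\<Sum>s<(p + 1) * M. x s * T p k $$ (s, j * M + m)) = (\<Sum>s<(p + 1) * M. T p k $$ (j * M + m, s) * x s)"
    by (intro sum.cong) (auto simp: mult.commute)
  with 1 show "(\<Sum>s<(p + 1) * M. x s * T p k $$ (s, j * M + m)) =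
     of_real (\<beta> k) * (\<Sum>i<p + 1. of_real (\<alpha> ^ nat \<bar>int j - int i\<bar>) * x (i * M + m))
     + of_real (1 / p_p) * x (j * M + m)"
    by simp
qed

lemma norm_class_sum_le:
  fixes x :: "nat \<Rightarrow> complex"
  shows "cmod (\<Sum>i<p + 1. of_real (\<alpha> ^ nat \<bar>int j - int i\<bar>) * x i) \<le> (\<Sum>i<p + 1. cmod (x i))"
proof (rule sum_norm_le)
  fix i
  show "cmod (of_real (\<alpha> ^ nat \<bar>int j - int i\<bar>) * x i) \<le> cmod (x i)"
    using abs_alpha_power_le[of "nat \<bar>int j - int i\<bar>"]
    by (simp add: norm_mult norm_power mult_left_le_one_le power_abs)
qed

text \<open>Multiplied by \<open>p_p\<close>, the system becomes the identity plus a perturbation of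
  size at most \<open>p_p * \<beta> k * real (p + 1)\<close>, a contraction by the smallness
  condition. With \<open>a = 0\<close> it gives injectivity and vanishing entries; with
  \<open>a = \<beta> k\<close> it gives the size of the filter.\<close>

lemma T_solution_bound:
  fixes x :: "nat \<Rightarrow> complex"
  assumes k: "k \<in> {1..K}" and small: "p_p * \<beta> k * real (p + 1) \<le> 1 / 2" and "0 \<le> a"
    and eq: "\<And>j. j < p + 1 \<Longrightarrow>
      cmod (of_real (\<beta> k) * (\<Sum>i<p + 1. of_real (\<alpha> ^ nat \<bar>int j - int i\<bar>) * x i) + of_real (1 / p_p) * x j) \<le> a"
    and "j < p + 1"
  shows "cmod (x j) \<le> 2 * (p_p * a)"
proof (rule sup_norm_contraction[where S = "{..<p + 1}" and c = "p_p * \<beta> k" and x = x])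
  note pos = p_p_pos[OF k] fading_pos[OF k]
  show "0 \<le> p_p * a" "0 \<le> p_p * \<beta> k"
    using pos \<open>0 \<le> a\<close> by auto
  fix j assume "j \<in> {..<p + 1}"
  let ?s = "(\<Sum>i<p + 1. of_real (\<alpha> ^ nat \<bar>int j - int i\<bar>) * x i)"
  define y where "y = of_real (\<beta> k) * ?s + of_real (1 / p_p) * x j"
  have "x j = of_real p_p * (y - of_real (\<beta> k) * ?s)"
    using pos by (simp add: y_def)
  then have "cmod (x j) = p_p * cmod (y - of_real (\<beta> k) * ?s)"
    using pos by (simp only: norm_mult norm_of_real abs_of_pos)
  also have "\<dots> \<le> p_p * (cmod y + cmod (of_real (\<beta> k) * ?s))"
    using pos by (intro mult_left_mono norm_triangle_ineq4) auto
  also have "\<dots> \<le> p_p * (a + \<beta> k * (\<Sum>i<p + 1. cmod (x i)))"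
    using pos eq[of j] \<open>j \<in> _\<close> norm_class_sum_le[where x = x and j = j and p = p]
    by (intro mult_left_mono add_mono) (auto simp: norm_mult y_def simp del: sum.lessThan_Suc)
  finally show "cmod (x j) \<le> p_p * a + p_p * \<beta> k * (\<Sum>i\<in>{..<p + 1}. cmod (x i))"
    by (simp add: algebra_simps)
qed (use assms in auto)

text \<open>At low power the contraction bound, applied to each antenna of a kernel vector, already
  gives invertibility, so positive definiteness need not be developed.\<close>

lemma T_inv:
  assumes k: "k \<in> {1..K}" and small: "p_p * \<beta> k * real (p + 1) \<le> 1 / 2"
  shows "T_inv p k \<in> carrier_mat ((p + 1) * M) ((p + 1) * M)"
    and "T_inv p k * T p k = 1\<^sub>m ((p + 1) * M)"
proof -
  note M = antennas_pos[OF k]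
  have "det (T p k) \<noteq> 0"
  proof
    assume "det (T p k) = 0"
    then obtain v where v: "v \<in> carrier_vec ((p + 1) * M)" "v \<noteq> 0\<^sub>v ((p + 1) * M)"
        "T p k *\<^sub>v v = 0\<^sub>v ((p + 1) * M)"
      using det_0_iff_vec_prod_zero_field[OF T_carrier] by blast
    have "v $ s = 0" if s: "s < (p + 1) * M" for s
    proof -
      have sm: "s div M < p + 1" "s mod M < M"
        using s M by (auto simp: less_mult_imp_div_less)
      have "cmod (v $ (s div M * M + s mod M)) \<le> 2 * (p_p * 0)"
      proof (rule T_solution_bound[where x = "\<lambda>j. v $ (j * M + s mod M)", OF k small])
        fix j assume j: "j < p + 1"
        have r: "j * M + s mod M < (p + 1) * M"
          by (rule block_index_less[OF j sm(2)])
        have "(\<Sum>i<(p + 1) * M. T p k $$ (j * M + s mod M, i) * v $ i) = (T p k *\<^sub>v v) $ (j * M + s mod M)"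
          using r v(1) T_carrier[of p k] by (auto simp: scalar_prod_def atLeast0LessThan intro!: sum.cong)
        also have "\<dots> = 0"
          using r v(3) by simp
        finally show "cmod (of_real (\<beta> k) * (\<Sum>i<p + 1. of_real (\<alpha> ^ nat \<bar>int j - int i\<bar>) * v $ (i * M + s mod M))
            + of_real (1 / p_p) * v $ (j * M + s mod M)) \<le> 0"
          unfolding sum_T_class(1)[OF j sm(2)] by simp
      qed (use sm in auto)
      then show ?thesis by simp
    qed
    then have "v = 0\<^sub>v ((p + 1) * M)"
      using v(1) by (intro eq_vecI) auto
    with v(2) show False by simp
  qed
  then have "T p k \<in> Units (ring_mat TYPE(complex) ((p + 1) * M) ())"
    by (rule det_non_zero_imp_unit[OF T_carrier])
  \<comment> \<open>\<open>mat_inverse\<close> yields \<open>None\<close> only for non-units, so the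
    \<open>the\<close> in the definition of \<open>T_inv\<close> is applied to a
    \<open>Some\<close>.\<close>
  then obtain B where B: "mat_inverse (T p k) = Some B"
    using mat_inverse(1)[OF T_carrier, where b = "()"] by (meson not_None_eq)
  from mat_inverse(2)[OF T_carrier B] B
  show "T_inv p k \<in> carrier_mat ((p + 1) * M) ((p + 1) * M)" "T_inv p k * T p k = 1\<^sub>m ((p + 1) * M)"
    by (auto simp: T_inv_def)
qed

section \<open>Entries of the prediction filter\<close>

lemma delta_kronecker_carrier: "\<delta> p \<otimes>\<^sub>K 1\<^sub>m M \<in> carrier_mat M ((p + 1) * M)"
  by (auto simp: kronecker_def \<delta>_def)

text \<open>Entries of \<open>q\<close> are estimated from this linear equation, never from an
  explicit inverse.\<close>

lemma q_T:
  assumes k: "k \<in> {1..K}" and small: "p_p * \<beta> k * real (p + 1) \<le> 1 / 2"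
  shows "q p k \<in> carrier_mat M ((p + 1) * M)"
    and "q p k * T p k = of_real (\<alpha> * \<beta> k) \<cdot>\<^sub>m (\<delta> p \<otimes>\<^sub>K 1\<^sub>m M)"
proof -
  note carriers = T_inv(1)[OF assms] T_carrier[of p k] delta_kronecker_carrier[of p]
  show "q p k \<in> carrier_mat M ((p + 1) * M)"
    unfolding q_def using carriers by auto
  have "q p k * T p k = of_real (\<alpha> * \<beta> k) \<cdot>\<^sub>m ((\<delta> p \<otimes>\<^sub>K 1\<^sub>m M) * T_inv p k * T p k)"
    unfolding q_def using carriers by (intro mult_smult_assoc_mat) auto
  also have "(\<delta> p \<otimes>\<^sub>K 1\<^sub>m M) * T_inv p k * T p k = (\<delta> p \<otimes>\<^sub>K 1\<^sub>m M) * (T_inv p k * T p k)"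
    using carriers by (intro assoc_mult_mat) auto
  also have "\<dots> = \<delta> p \<otimes>\<^sub>K 1\<^sub>m M"
    using carriers(3) by (simp add: T_inv(2)[OF assms])
  finally show "q p k * T p k = of_real (\<alpha> * \<beta> k) \<cdot>\<^sub>m (\<delta> p \<otimes>\<^sub>K 1\<^sub>m M)" .
qed

lemma q_equation:
  assumes k: "k \<in> {1..K}" and small: "p_p * \<beta> k * real (p + 1) \<le> 1 / 2"
    and "m < M" "m' < M" "j < p + 1"
  shows "of_real (\<beta> k) * (\<Sum>i<p + 1. of_real (\<alpha> ^ nat \<bar>int j - int i\<bar>) * q p k $$ (m, i * M + m'))
     + of_real (1 / p_p) * q p k $$ (m, j * M + m')
     = (if m' = m then of_real (\<alpha> * \<beta> k * \<alpha> ^ j) else 0)"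
proof -
  note qT = q_T[OF k small]
  have r: "j * M + m' < (p + 1) * M"
    using assms by (intro block_index_less)
  have "(\<Sum>s<(p + 1) * M. q p k $$ (m, s) * T p k $$ (s, j * M + m')) = (q p k * T p k) $$ (m, j * M + m')"
    using r assms qT(1) T_carrier[of p k] by (auto simp: scalar_prod_def atLeast0LessThan intro!: sum.cong)
  also have "\<dots> = (if m' = m then of_real (\<alpha> * \<beta> k * \<alpha> ^ j) else 0)"
    using r assms delta_kronecker_carrier[of p] by (auto simp: qT(2) index_delta_kronecker)
  finally show ?thesis
    using sum_T_class(2)[OF assms(5,4), of "\<lambda>s. q p k $$ (m, s)" k] by simp
qed

text \<open>Coefficients linking different antennas solve the homogeneous system. Hence the
  prediction of an antenna uses only the observations of that antenna.\<close>

lemma q_off_diagonal: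
  assumes k: "k \<in> {1..K}" and small: "p_p * \<beta> k * real (p + 1) \<le> 1 / 2"
    and "m < M" "m' < M" "j < p + 1" "m \<noteq> m'"
  shows "q p k $$ (m, j * M + m') = 0"
proof -
  have "cmod (q p k $$ (m, j * M + m')) \<le> 2 * (p_p * 0)"
    by (rule T_solution_bound[where x = "\<lambda>j. q p k $$ (m, j * M + m')", OF k small])
      (use assms in \<open>simp_all only: q_equation[OF k small assms(3,4)] assms(6)[symmetric] if_False norm_zero order_refl\<close>)
  then show ?thesis by simp
qed

lemma norm_q_diagonal_le:
  assumes k: "k \<in> {1..K}" and small: "p_p * \<beta> k * real (p + 1) \<le> 1 / 2"
    and "m < M" "j < p + 1"
  shows "cmod (q p k $$ (m, j * M + m)) \<le> 2 * p_p * \<beta> k"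
proof -
  have *: "\<bar>\<alpha> * \<beta> k * \<alpha> ^ i\<bar> \<le> \<beta> k" for i
    using abs_alpha_power_le[of "Suc i"] fading_pos[OF k]
    by (simp add: abs_mult mult.commute mult.left_commute mult_left_le power_abs)
  have "cmod (q p k $$ (m, j * M + m)) \<le> 2 * (p_p * \<beta> k)"
  proof (rule T_solution_bound[where x = "\<lambda>j. q p k $$ (m, j * M + m)", OF k small])
    fix j assume "j < p + 1"
    show "cmod (of_real (\<beta> k) * (\<Sum>i<p + 1. of_real (\<alpha> ^ nat \<bar>int j - int i\<bar>) * q p k $$ (m, i * M + m))
        + of_real (1 / p_p) * q p k $$ (m, j * M + m)) \<le> \<beta> k"
      unfolding q_equation[OF k small assms(3,3) \<open>j < p + 1\<close>] using *[of j]
      by (simp only: if_True simp_thms norm_of_real)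
  qed (use assms fading_pos[OF k] in auto)
  then show ?thesis by (simp add: mult.assoc)
qed

text \<open>One step of the fixed-point iteration: the equation times \<open>p_p\<close> displays
  the deviation as \<open>p_p * \<beta> k\<close> times a sum of \<open>p + 1\<close> filter
  entries, each already known to be of order \<open>p_p\<close>.\<close>

lemma q_diagonal_first_order:
  assumes k: "k \<in> {1..K}" and small: "p_p * \<beta> k * real (p + 1) \<le> 1 / 2"
    and "m < M" "j < p + 1"
  shows "cmod (q p k $$ (m, j * M + m) - of_real (p_p * (\<alpha> * \<beta> k * \<alpha> ^ j)))
    \<le> 2 * real (p + 1) * (p_p * \<beta> k)\<^sup>2"
proof -
  note pos = p_p_pos[OF k] fading_pos[OF k]
  let ?s = "\<Sum>i<p + 1. of_real (\<alpha> ^ nat \<bar>int j - int i\<bar>) * q p k $$ (m, i * M + m)"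
  have "of_real p_p * (of_real (\<beta> k) * ?s + of_real (1 / p_p) * q p k $$ (m, j * M + m))
      = of_real (p_p * (\<alpha> * \<beta> k * \<alpha> ^ j))"
    unfolding q_equation[OF k small assms(3,3,4)] by simp
  then have "q p k $$ (m, j * M + m) - of_real (p_p * (\<alpha> * \<beta> k * \<alpha> ^ j)) = - of_real (p_p * \<beta> k) * ?s"
    using pos by (simp add: algebra_simps add_eq_0_iff)
  then have "cmod (q p k $$ (m, j * M + m) - of_real (p_p * (\<alpha> * \<beta> k * \<alpha> ^ j))) = p_p * \<beta> k * cmod ?s"
    using pos by (simp add: norm_mult del: of_real_mult)
  also have "\<dots> \<le> p_p * \<beta> k * (\<Sum>i<p + 1. cmod (q p k $$ (m, i * M + m)))"
    using pos by (intro mult_left_mono norm_class_sum_le) auto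
  also have "\<dots> \<le> p_p * \<beta> k * (real (card {..<p + 1}) * (2 * p_p * \<beta> k))"
    using pos assms by (intro mult_left_mono sum_bounded_above norm_q_diagonal_le) auto
  also have "\<dots> = 2 * real (p + 1) * (p_p * \<beta> k)\<^sup>2"
    by (simp add: power2_eq_square)
  finally show ?thesis .
qed

lemma predicted_channel_index:
  assumes k: "k \<in> {1..K}" and small: "p_p * \<beta> k * real (p + 1) \<le> 1 / 2" and "m < M"
  shows "predicted_channel p k n \<omega> $ m = (\<Sum>j<p + 1. q p k $$ (m, j * M + m) *
    (g k (n - int j) m \<omega> + of_real (1 / sqrt p_p) * b k (n - int j) m \<omega>))"
proof -
  have M: "0 < M" using assms by simp
  let ?o = "\<lambda>j m. observation k (n - int j) \<omega> $ m"
  have "predicted_channel p k n \<omega> $ m = (\<Sum>s<(p + 1) * M. q p k $$ (m, s div M * M + s mod M) * ?o (s div M) (s mod M))"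
    using q_T(1)[OF k small] \<open>m < M\<close>
    by (auto simp: predicted_channel_def stacked_observation_def scalar_prod_def atLeast0LessThan mult.commute[of M] intro!: sum.cong)
  also have "\<dots> = (\<Sum>j<p + 1. \<Sum>m'<M. q p k $$ (m, j * M + m') * ?o j m')"
    by (rule sum_div_mod[OF M])
  also have "\<dots> = (\<Sum>j<p + 1. \<Sum>m'<M. if m' = m then q p k $$ (m, j * M + m') * ?o j m' else 0)"
    using \<open>m < M\<close> q_off_diagonal[OF k small, of m] by (intro sum.cong refl) auto
  also have "\<dots> = (\<Sum>j<p + 1. q p k $$ (m, j * M + m) * ?o j m)"
    using \<open>m < M\<close> by simp
  finally show ?thesis
    using \<open>m < M\<close> by (simp add: observation_def)
qed

lemma dim_predicted_channel:
  assumes k: "k \<in> {1..K}" and small: "p_p * \<beta> k * real (p + 1) \<le> 1 / 2"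
  shows "dim_vec (predicted_channel p k n \<omega>) = M"
  using q_T(1)[OF assms] by (auto simp: predicted_channel_def)

text \<open>The quantity is the mean-square prediction error per antenna. A crude bound uniform in
  \<open>M\<close> suffices, since the SINR multiplies it by \<open>p_u\<close>.\<close>

lemma trace_prediction_error_bound:
  assumes k: "k \<in> {1..K}" and small: "p_p * \<beta> k * real (p + 1) \<le> 1 / 2"
  shows "\<bar>1 / real M * Re (mat_trace (of_real (\<beta> k) \<cdot>\<^sub>m 1\<^sub>m M - of_real (\<alpha>\<^sup>2) \<cdot>\<^sub>m \<Theta> p k))\<bar> \<le> 2 * \<beta> k"
proof -
  note M = antennas_pos[OF k] and pos = p_p_pos[OF k] fading_pos[OF k]
  let ?D = "\<delta> p \<otimes>\<^sub>K 1\<^sub>m M"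
  note carriers = T_inv(1)[OF assms] T_carrier[of p k] delta_kronecker_carrier[of p] q_T(1)[OF assms]
  from carriers(3) have dim: "dim_row ?D = M" "dim_col ?D = (p + 1) * M"
    by (simp_all only: carrier_matD)
  have adj: "mat_adjoint ?D \<in> carrier_mat ((p + 1) * M) M"
    unfolding mat_adjoint_def using dim by (intro carrier_matI) (simp_all only: mat_of_rows_carrier length_map cols_length)
  have adj_index: "mat_adjoint ?D $$ (s, m) = cnj (?D $$ (m, s))" if ms: "m < M" "s < (p + 1) * M" for m s
  proof -
    have "mat_adjoint ?D $$ (s, m) = map conjugate (cols ?D) ! s $ m"
      unfolding mat_adjoint_def dim using ms dim by (intro mat_of_rows_index) (simp_all only: length_map cols_length)
    also have "\<dots> = conjugate (col ?D s) $ m"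
      using ms dim by (simp only: nth_map cols_length cols_nth)
    also have "\<dots> = cnj (?D $$ (m, s))"
      using ms dim by (simp only: vec_index_conjugate dim_col index_col conjugate_complex_def)
    finally show ?thesis .
  qed
  \<comment> \<open>Of the factor \<open>\<alpha>\<^sup>2 * (\<beta> k)\<^sup>2\<close>, one
    \<open>\<alpha> * \<beta> k\<close> completes the filter \<open>q\<close>, whose entries are
    already bounded.\<close>
  have Th: "of_real (\<alpha>\<^sup>2) \<cdot>\<^sub>m \<Theta> p k = of_real (\<alpha> * \<beta> k) \<cdot>\<^sub>m (q p k * mat_adjoint ?D)"
  proof -
    let ?X = "?D * T_inv p k * mat_adjoint ?D"
    have "q p k * mat_adjoint ?D = of_real (\<alpha> * \<beta> k) \<cdot>\<^sub>m ?X"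
      unfolding q_def by (rule mult_smult_assoc_mat[OF mult_carrier_mat[OF carriers(3,1)] adj])
    moreover have "of_real (\<alpha>\<^sup>2) * of_real ((\<beta> k)\<^sup>2) = of_real (\<alpha> * \<beta> k) * complex_of_real (\<alpha> * \<beta> k)"
      by (simp add: power2_eq_square)
    ultimately show ?thesis
      unfolding \<Theta>_def by (intro eq_matI) (simp_all only: index_smult_mat mult.assoc[symmetric])
  qed
  have diag: "cmod ((q p k * mat_adjoint ?D) $$ (m, m)) \<le> real (p + 1) * (2 * p_p * \<beta> k)" if m: "m < M" for m
  proof -
    have "(q p k * mat_adjoint ?D) $$ (m, m) = (\<Sum>s<(p + 1) * M. q p k $$ (m, s) * mat_adjoint ?D $$ (s, m))"
      using m carriers(4) adj by (auto simp: scalar_prod_def atLeast0LessThan intro!: sum.cong)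
    also have "\<dots> = (\<Sum>s<(p + 1) * M. if s mod M = m then q p k $$ (m, s div M * M + s mod M) * of_real (\<alpha> ^ (s div M)) else 0)"
      using m by (intro sum.cong) (auto simp: adj_index index_delta_kronecker)
    also have "\<dots> = (\<Sum>j<p + 1. \<Sum>m'<M. if m' = m then q p k $$ (m, j * M + m') * of_real (\<alpha> ^ j) else 0)"
      by (rule sum_div_mod[OF M])
    also have "\<dots> = (\<Sum>j<p + 1. q p k $$ (m, j * M + m) * of_real (\<alpha> ^ j))"
      using m by simp
    also have "cmod \<dots> \<le> (\<Sum>j<p + 1. 2 * p_p * \<beta> k)"
    proof (rule sum_norm_le)
      fix j assume "j \<in> {..<p + 1}"
      then have "cmod (q p k $$ (m, j * M + m)) * \<bar>\<alpha> ^ j\<bar> \<le> 2 * p_p * \<beta> k * 1"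
        using m pos abs_alpha_power_le norm_q_diagonal_le[OF assms, of m j] by (intro mult_mono) auto
      then show "cmod (q p k $$ (m, j * M + m) * of_real (\<alpha> ^ j)) \<le> 2 * p_p * \<beta> k"
        by (simp add: norm_mult norm_power power_abs)
    qed
    finally show ?thesis by simp
  qed
  have ab: "\<bar>\<alpha> * \<beta> k\<bar> \<le> \<beta> k"
    using alpha_bound pos by (simp add: abs_mult mult_left_le_one_le)
  let ?A = "of_real (\<beta> k) \<cdot>\<^sub>m 1\<^sub>m M - of_real (\<alpha>\<^sup>2) \<cdot>\<^sub>m \<Theta> p k"
  have entry: "cmod (?A $$ (m, m)) \<le> 2 * \<beta> k" if m: "m < M" for m
  proof -
    have "?A $$ (m, m) = of_real (\<beta> k) - of_real (\<alpha> * \<beta> k) * (q p k * mat_adjoint ?D) $$ (m, m)"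
      unfolding Th using m carriers(4) adj by (simp del: index_mult_mat(1))
    then have "cmod (?A $$ (m, m)) \<le> \<beta> k + \<bar>\<alpha> * \<beta> k\<bar> * cmod ((q p k * mat_adjoint ?D) $$ (m, m))"
      using pos norm_triangle_ineq4 by (smt (verit) norm_mult norm_of_real)
    also have "\<dots> \<le> \<beta> k + \<beta> k * (real (p + 1) * (2 * p_p * \<beta> k))"
      using ab diag[OF m] pos by (intro add_mono mult_mono) auto
    also have "\<dots> = \<beta> k + \<beta> k * (2 * (p_p * \<beta> k * real (p + 1)))"
      by (simp add: algebra_simps)
    \<comment> \<open>The smallness condition says precisely that twice the bracket is at most
      1.\<close>
    also have "\<dots> \<le> \<beta> k + \<beta> k * 1"
      using small pos by (intro add_mono mult_left_mono) auto
    finally show ?thesis by simp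
  qed
  have dim_A: "dim_row ?A = M"
    unfolding Th using carriers(4) adj by simp
  have "\<bar>Re (mat_trace ?A)\<bar> \<le> cmod (mat_trace ?A)"
    by (rule abs_Re_le_cmod)
  also have "\<dots> \<le> (\<Sum>m<M. 2 * \<beta> k)"
    unfolding mat_trace_def dim_A using entry by (intro sum_norm_le) auto
  finally show ?thesis
    using M by (simp add: abs_mult field_simps)
qed

end

section \<open>The predicted channel\<close>

definition complex_normal_moment4 :: "real \<Rightarrow> real" where
  "complex_normal_moment4 v = (\<integral>z. cmod z ^ 4 \<partial>complex_normal v)"

context uplink
begin

lemma channel_measurable:
  assumes "k \<in> {1..K}" "m < M"
  shows "g k n m \<in> borel_measurable \<Omega>"
  using channel_entries_indep[OF assms(1), of n] assms(2) by (auto simp: indep_vars_def)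

lemma noise_measurable:
  assumes "k \<in> {1..K}" "m < M"
  shows "b k n m \<in> borel_measurable \<Omega>"
proof -
  have "(case (k, n, m) of (k, n, m) \<Rightarrow> b k n m) \<in> borel_measurable \<Omega>"
    using noise_indep assms unfolding indep_vars_def by blast
  then show ?thesis by simp
qed

lemma channel_moment4:
  assumes "k \<in> {1..K}" "m < M"
  shows "integrable \<Omega> (\<lambda>\<omega>. cmod (g k n m \<omega>) ^ 4)"
    and "expectation (\<lambda>\<omega>. cmod (g k n m \<omega>) ^ 4) = complex_normal_moment4 (\<beta> k)"
proof -
  note [measurable] = channel_measurable[OF assms, of n]
  show "integrable \<Omega> (\<lambda>\<omega>. cmod (g k n m \<omega>) ^ 4)"
    using integrable_distr_eq[of "g k n m" \<Omega> borel "\<lambda>z. cmod z ^ 4"] channel_entries_law[OF assms, of n]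
      integrable_complex_normal_power4[OF fading_pos[OF assms(1)]] by simp
  show "expectation (\<lambda>\<omega>. cmod (g k n m \<omega>) ^ 4) = complex_normal_moment4 (\<beta> k)"
    using integral_distr[of "g k n m" \<Omega> borel "\<lambda>z. cmod z ^ 4"] channel_entries_law[OF assms, of n]
    by (simp add: complex_normal_moment4_def)
qed

lemma noise_moments:
  assumes "k \<in> {1..K}" "m < M"
  shows "integrable \<Omega> (\<lambda>\<omega>. cmod (b k n m \<omega>) ^ 4)"
    and "expectation (\<lambda>\<omega>. cmod (b k n m \<omega>) ^ 4) = complex_normal_moment4 1"
    and "expectation (b k n m) = 0"
    and "integrable \<Omega> (\<lambda>\<omega>. (cmod (b k n m \<omega>))\<^sup>2)"
    and "expectation (\<lambda>\<omega>. (cmod (b k n m \<omega>))\<^sup>2) = 1"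
proof -
  note [measurable] = noise_measurable[OF assms, of n]
  show 1: "integrable \<Omega> (\<lambda>\<omega>. cmod (b k n m \<omega>) ^ 4)"
    using integrable_distr_eq[of "b k n m" \<Omega> borel "\<lambda>z. cmod z ^ 4"] noise_law[OF assms, of n]
      integrable_complex_normal_power4[of 1] by simp
  show "expectation (\<lambda>\<omega>. cmod (b k n m \<omega>) ^ 4) = complex_normal_moment4 1"
    using integral_distr[of "b k n m" \<Omega> borel "\<lambda>z. cmod z ^ 4"] noise_law[OF assms, of n]
    by (simp add: complex_normal_moment4_def)
  show "expectation (b k n m) = 0"
  proof -
    have "expectation (\<lambda>\<omega>. b k n m \<omega>) = (\<integral>z. z \<partial>distr \<Omega> borel (b k n m))"
      by (rule integral_distr[symmetric]) simp_all
    also have "\<dots> = 0"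
      unfolding noise_law[OF assms] by (rule integral_complex_normal) simp
    finally show ?thesis .
  qed
  show "integrable \<Omega> (\<lambda>\<omega>. (cmod (b k n m \<omega>))\<^sup>2)"
    by (rule integrable_square_of_power4) (use 1 in auto)
  show "expectation (\<lambda>\<omega>. (cmod (b k n m \<omega>))\<^sup>2) = 1"
    using integral_distr[of "b k n m" \<Omega> borel "\<lambda>z. (cmod z)\<^sup>2"] noise_law[OF assms, of n]
      integral_complex_normal_square[of 1]
    by simp
qed

section \<open>The leading noise part and a common majorant\<close>

definition noise_part :: "nat \<Rightarrow> int \<Rightarrow> nat \<Rightarrow> nat \<Rightarrow> 'w \<Rightarrow> complex" where
  "noise_part p n k m \<omega> = (\<Sum>j<p + 1. of_real (\<alpha> * \<beta> k * \<alpha> ^ j) * b k (n - int j) m \<omega>)"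

definition noise_part_power :: "nat \<Rightarrow> nat \<Rightarrow> real" where
  "noise_part_power p k = (\<Sum>j<p + 1. (\<alpha> * \<beta> k * \<alpha> ^ j)\<^sup>2)"

text \<open>The constant adds two coefficient bounds divided by powers of \<open>p_p\<close>:
  \<open>2 * B\<close> for the size of the filter and \<open>2 * real (p + 1) * B\<^sup>2\<close>
  for its first-order error. One variable then majorises both the noise part and the approximation
  error.\<close>

definition dominating :: "real \<Rightarrow> nat \<Rightarrow> int \<Rightarrow> nat \<Rightarrow> nat \<Rightarrow> 'w \<Rightarrow> real" where
  "dominating B p n k m \<omega> = (2 * B + 2 * real (p + 1) * B\<^sup>2) *
     (\<Sum>j<p + 1. cmod (g k (n - int j) m \<omega>) + cmod (b k (n - int j) m \<omega>))"

lemma noise_part_measurable: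
  assumes "k \<in> {1..K}" "m < M"
  shows "noise_part p n k m \<in> borel_measurable \<Omega>"
  unfolding noise_part_def [abs_def] using noise_measurable[OF assms]
  by (intro borel_measurable_sum borel_measurable_times) auto

lemma dominating_measurable:
  assumes "k \<in> {1..K}" "m < M"
  shows "dominating B p n k m \<in> borel_measurable \<Omega>"
  unfolding dominating_def [abs_def] using noise_measurable[OF assms] channel_measurable[OF assms]
  by (intro borel_measurable_sum borel_measurable_times borel_measurable_add borel_measurable_norm) auto

lemma noise_part_le_dominating:
  assumes k: "k \<in> {1..K}" and "\<beta> k \<le> B"
  shows "cmod (noise_part p n k m \<omega>) \<le> dominating B p n k m \<omega>"
proof -
  note pos = fading_pos[OF k]
  have B: "0 \<le> B" using pos assms by simp
  have c: "\<bar>\<alpha> * \<beta> k * \<alpha> ^ j\<bar> \<le> 2 * B + 2 * real (p + 1) * B\<^sup>2" for j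
  proof -
    have "\<bar>\<alpha> * \<beta> k * \<alpha> ^ j\<bar> = \<beta> k * \<bar>\<alpha> ^ Suc j\<bar>"
      using pos by (simp add: abs_mult)
    also have "\<dots> \<le> B * 1"
      using abs_alpha_power_le[of "Suc j"] assms pos by (intro mult_mono) auto
    also have "\<dots> \<le> 2 * B + 2 * real (p + 1) * B\<^sup>2"
      using B by simp
    finally show ?thesis .
  qed
  have "cmod (noise_part p n k m \<omega>) \<le>
    (\<Sum>j<p + 1. (2 * B + 2 * real (p + 1) * B\<^sup>2) * (cmod (g k (n - int j) m \<omega>) + cmod (b k (n - int j) m \<omega>)))"
    unfolding noise_part_def
  proof (rule sum_norm_le)
    fix j
    have "cmod (of_real (\<alpha> * \<beta> k * \<alpha> ^ j) * b k (n - int j) m \<omega>) = \<bar>\<alpha> * \<beta> k * \<alpha> ^ j\<bar> * cmod (b k (n - int j) m \<omega>)"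
      by (simp only: norm_mult norm_of_real)
    also have "\<dots> \<le> (2 * B + 2 * real (p + 1) * B\<^sup>2) * (cmod (g k (n - int j) m \<omega>) + cmod (b k (n - int j) m \<omega>))"
      using c[of j] by (intro mult_mono) auto
    finally show "cmod (of_real (\<alpha> * \<beta> k * \<alpha> ^ j) * b k (n - int j) m \<omega>) \<le> \<dots>" .
  qed
  then show ?thesis
    by (simp only: dominating_def sum_distrib_left)
qed

text \<open>The channel enters through filter coefficients of order \<open>p_p\<close>. The noise is
  amplified by \<open>1 / sqrt p_p\<close>, but its coefficients are off by order
  \<open>p_p^2\<close> only. Both contributions are thus at most of order
  \<open>p_p\<close>.\<close>

lemma prediction_approx_noise_part:
  assumes k: "k \<in> {1..K}" and B: "\<beta> k \<le> B" and small: "p_p * B * real (p + 1) \<le> 1 / 2" and "p_p \<le> 1"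
    and m: "m < M"
  shows "cmod (predicted_channel p k n \<omega> $ m - of_real (sqrt p_p) * noise_part p n k m \<omega>)
    \<le> p_p * dominating B p n k m \<omega>"
proof -
  note pos = p_p_pos[OF k] fading_pos[OF k]
  have "p_p * \<beta> k * real (p + 1) \<le> p_p * B * real (p + 1)"
    using pos B by (intro mult_right_mono mult_left_mono) auto
  then have small': "p_p * \<beta> k * real (p + 1) \<le> 1 / 2"
    using small by simp
  have B0: "0 \<le> B" using pos B by simp
  define C where "C = 2 * B + 2 * real (p + 1) * B\<^sup>2"
  define a where "a j = complex_of_real (p_p * (\<alpha> * \<beta> k * \<alpha> ^ j))" for j
  define x where "x j = q p k $$ (m, j * M + m)" for j
  define gg where "gg j = g k (n - int j) m \<omega>" for j
  define bb where "bb j = b k (n - int j) m \<omega>" for j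
  \<comment> \<open>A filter of order \<open>p_p\<close> times a noise weight
    \<open>1 / sqrt p_p\<close> produces the scale \<open>sqrt p_p\<close> of the leading
    part.\<close>
  have root: "of_real (sqrt p_p) * (of_real (\<alpha> * \<beta> k * \<alpha> ^ j) * z) = a j * (of_real (1 / sqrt p_p) * z)" for j z
  proof -
    have "sqrt p_p * (\<alpha> * \<beta> k * \<alpha> ^ j) = p_p * (\<alpha> * \<beta> k * \<alpha> ^ j) * (1 / sqrt p_p)"
      using pos by (simp add: field_simps)
    then have "complex_of_real (sqrt p_p) * of_real (\<alpha> * \<beta> k * \<alpha> ^ j) = a j * of_real (1 / sqrt p_p)"
      unfolding a_def by (simp only: of_real_mult[symmetric])
    then show ?thesis by (metis mult.assoc)
  qed
  have "predicted_channel p k n \<omega> $ m - of_real (sqrt p_p) * noise_part p n k m \<omega>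
      = (\<Sum>j<p + 1. x j * (gg j + of_real (1 / sqrt p_p) * bb j)) - (\<Sum>j<p + 1. a j * (of_real (1 / sqrt p_p) * bb j))"
    by (simp only: predicted_channel_index[OF k small' m] noise_part_def sum_distrib_left root x_def gg_def bb_def)
  also have "\<dots> = (\<Sum>j<p + 1. x j * gg j + (x j - a j) * of_real (1 / sqrt p_p) * bb j)"
    unfolding sum_subtractf[symmetric] by (intro sum.cong refl) (simp only: algebra_simps)
  also have "cmod \<dots> \<le> (\<Sum>j<p + 1. p_p * C * (cmod (gg j) + cmod (bb j)))"
  proof (rule sum_norm_le)
    fix j assume "j \<in> {..<p + 1}"
    then have j: "j < p + 1" by simp
    have 1: "cmod (x j) \<le> p_p * C"
    proof -
      have "cmod (x j) \<le> 2 * p_p * \<beta> k"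
        unfolding x_def by (rule norm_q_diagonal_le[OF k small' m j])
      also have "\<dots> \<le> p_p * (2 * B)" using pos B by simp
      also have "\<dots> \<le> p_p * C"
        using pos by (intro mult_left_mono) (auto simp: C_def)
      finally show ?thesis .
    qed
    \<comment> \<open>The true order is \<open>p_p * sqrt p_p\<close>; the spare root is discarded
      using \<open>p_p \<le> 1\<close>.\<close>
    have 2: "cmod (x j - a j) * (1 / sqrt p_p) \<le> p_p * C"
    proof -
      have "cmod (x j - a j) * (1 / sqrt p_p) \<le> 2 * real (p + 1) * (p_p * \<beta> k)\<^sup>2 * (1 / sqrt p_p)"
        unfolding x_def a_def using pos by (intro mult_right_mono q_diagonal_first_order[OF k small' m j]) auto
      also have "\<dots> = p_p * (2 * real (p + 1) * (\<beta> k)\<^sup>2) * sqrt p_p"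
        using pos by (simp add: field_simps power2_eq_square)
      also have "\<dots> \<le> p_p * (2 * real (p + 1) * (\<beta> k)\<^sup>2) * 1"
        using pos \<open>p_p \<le> 1\<close> by (intro mult_left_mono) auto
      also have "\<dots> \<le> p_p * (2 * real (p + 1) * B\<^sup>2)"
        using pos B by (simp add: power_mono)
      also have "\<dots> \<le> p_p * C"
        using pos B0 by (intro mult_left_mono) (auto simp: C_def)
      finally show ?thesis .
    qed
    have "cmod (x j * gg j + (x j - a j) * of_real (1 / sqrt p_p) * bb j) \<le>
        cmod (x j) * cmod (gg j) + cmod (x j - a j) * (1 / sqrt p_p) * cmod (bb j)"
      using pos by (intro order_trans[OF norm_triangle_ineq]) (simp add: norm_mult norm_divide)
    also have "\<dots> \<le> p_p * C * cmod (gg j) + p_p * C * cmod (bb j)"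
      using 1 2 by (intro add_mono mult_right_mono) auto
    finally show "cmod (x j * gg j + (x j - a j) * of_real (1 / sqrt p_p) * bb j) \<le> p_p * C * (cmod (gg j) + cmod (bb j))"
      by (simp only: distrib_left)
  qed
  also have "\<dots> = p_p * dominating B p n k m \<omega>"
    by (simp only: dominating_def C_def gg_def bb_def sum_distrib_left mult.assoc)
  finally show ?thesis .
qed

text \<open>The factor \<open>8 * real (p + 1) ^ 4\<close> is \<open>2 ^ 3\<close> for splitting
  channel from noise, \<open>(p + 1) ^ 3\<close> for the fourth power of a sum over lags, and
  \<open>p + 1\<close> for adding the lags up. Summing over all users makes the bound common to
  them, and the leading 1 secures \<open>1 \<le> D\<close>. No term depends on
  \<open>M\<close>.\<close>

definition dominating_moment4 :: "real \<Rightarrow> nat \<Rightarrow> real" where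
  "dominating_moment4 B p = 1 + (2 * B + 2 * real (p + 1) * B\<^sup>2) ^ 4 * (8 * real (p + 1) ^ 4 *
     ((\<Sum>i=1..K. complex_normal_moment4 (\<beta> i)) + complex_normal_moment4 1))"

lemma complex_normal_moment4_nonneg: "0 \<le> complex_normal_moment4 v"
  unfolding complex_normal_moment4_def by (intro Bochner_Integration.integral_nonneg) auto

lemma dominating_moment4_ge_1: "1 \<le> dominating_moment4 B p"
  unfolding dominating_moment4_def
  by (simp add: complex_normal_moment4_nonneg sum_nonneg)

lemma expectation_dominating_power4:
  assumes k: "k \<in> {1..K}" and m: "m < M"
  shows "integrable \<Omega> (\<lambda>\<omega>. dominating B p n k m \<omega> ^ 4)"
    and "expectation (\<lambda>\<omega>. dominating B p n k m \<omega> ^ 4) \<le> dominating_moment4 B p"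
proof -
  define C where "C = 2 * B + 2 * real (p + 1) * B\<^sup>2"
  define R where "R \<omega> = C ^ 4 * (8 * real (p + 1) ^ 3 *
    (\<Sum>j<p + 1. cmod (g k (n - int j) m \<omega>) ^ 4 + cmod (b k (n - int j) m \<omega>) ^ 4))" for \<omega>
  have le: "dominating B p n k m \<omega> ^ 4 \<le> R \<omega>" for \<omega>
  proof -
    have two: "(s + t) ^ 4 \<le> 8 * (s ^ 4 + t ^ 4)" for s t :: real
      using sum_power4_le[of "\<lambda>i. if i = 0 then s else t" "{0, 1::nat}"] by simp
    have "(\<Sum>j<p + 1. cmod (g k (n - int j) m \<omega>) + cmod (b k (n - int j) m \<omega>)) ^ 4
      \<le> real (card {..<p + 1}) ^ 3 * (\<Sum>j<p + 1. (cmod (g k (n - int j) m \<omega>) + cmod (b k (n - int j) m \<omega>)) ^ 4)"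
      by (rule sum_power4_le)
    also have "\<dots> \<le> real (p + 1) ^ 3 * (\<Sum>j<p + 1. 8 * (cmod (g k (n - int j) m \<omega>) ^ 4 + cmod (b k (n - int j) m \<omega>) ^ 4))"
      unfolding card_lessThan by (intro mult_left_mono sum_mono two) auto
    also have "\<dots> = 8 * real (p + 1) ^ 3 * (\<Sum>j<p + 1. cmod (g k (n - int j) m \<omega>) ^ 4 + cmod (b k (n - int j) m \<omega>) ^ 4)"
      by (simp only: sum_distrib_left[symmetric] mult_ac)
    finally show ?thesis
      unfolding dominating_def R_def power_mult_distrib C_def[symmetric] by (intro mult_left_mono) auto
  qed
  have R: "has_bochner_integral \<Omega> R (C ^ 4 * (8 * real (p + 1) ^ 3 *
    (\<Sum>j<p + 1. expectation (\<lambda>\<omega>. cmod (g k (n - int j) m \<omega>) ^ 4) + expectation (\<lambda>\<omega>. cmod (b k (n - int j) m \<omega>) ^ 4))))"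
    unfolding R_def [abs_def]
    by (intro has_bochner_integral_add has_bochner_integral_sum has_bochner_integral_mult_right has_bochner_integral_integrable
        channel_moment4[OF k m] noise_moments[OF k m])
  then have intR: "integrable \<Omega> R"
    by (rule integrable.intros)
  note [measurable] = dominating_measurable[OF k m, of B p n]
  show int: "integrable \<Omega> (\<lambda>\<omega>. dominating B p n k m \<omega> ^ 4)"
    by (rule Bochner_Integration.integrable_bound[OF intR]) (use le in \<open>auto intro!: AE_I2 order_trans[OF _ abs_ge_self]\<close>)
  have "expectation (\<lambda>\<omega>. dominating B p n k m \<omega> ^ 4) \<le> expectation R"
    using int intR le by (intro integral_mono) auto
  also have "\<dots> = C ^ 4 * (8 * real (p + 1) ^ 3 * (\<Sum>j<p + 1. complex_normal_moment4 (\<beta> k) + complex_normal_moment4 1))"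
    unfolding has_bochner_integral_integral_eq[OF R] channel_moment4[OF k m] noise_moments[OF k m] ..
  also have "\<dots> = C ^ 4 * (8 * real (p + 1) ^ 4 * (complex_normal_moment4 (\<beta> k) + complex_normal_moment4 1))"
    by (simp add: power4_eq_xxxx power3_eq_cube)
  also have "\<dots> \<le> C ^ 4 * (8 * real (p + 1) ^ 4 * ((\<Sum>i=1..K. complex_normal_moment4 (\<beta> i)) + complex_normal_moment4 1))"
    using k complex_normal_moment4_nonneg
    by (intro mult_left_mono add_mono order_refl member_le_sum[of k _ "\<lambda>i. complex_normal_moment4 (\<beta> i)"]) auto
  also have "\<dots> \<le> dominating_moment4 B p"
    by (simp add: dominating_moment4_def C_def)
  finally show "expectation (\<lambda>\<omega>. dominating B p n k m \<omega> ^ 4) \<le> dominating_moment4 B p" .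
qed

text \<open>Noise of different users or different times is orthogonal, so the double sum over lags
  collapses to its diagonal, and only for a user against itself.\<close>

lemma expectation_noise_part_mult:
  assumes i: "i \<in> {1..K}" and k: "k \<in> {1..K}" and m: "m < M"
  shows "has_bochner_integral \<Omega> (\<lambda>\<omega>. noise_part p n i m \<omega> * cnj (noise_part p n k m \<omega>))
    (if i = k then of_real (noise_part_power p k) else 0)"
proof -
  define c where "c k j = complex_of_real (\<alpha> * \<beta> k * \<alpha> ^ j)" for k j
  have bb: "has_bochner_integral \<Omega> (\<lambda>\<omega>. b i (n - int j) m \<omega> * cnj (b k (n - int l) m \<omega>))
      (if i = k \<and> j = l then 1 else 0)" for j l
  proof -
    define X where "X = (\<lambda>(k, n, m). b k n m)"
    have ind: "indep_vars (\<lambda>_. borel) X ({1..K} \<times> UNIV \<times> {..<M})"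
      unfolding X_def by (rule noise_indep)
    have sq: "integrable \<Omega> (\<lambda>\<omega>. (cmod (X x \<omega>))\<^sup>2)" and mean: "expectation (X x) = 0"
      if "x \<in> {1..K} \<times> UNIV \<times> {..<M}" for x
      using that noise_moments by (auto simp: X_def)
    have mem: "(i, n - int j, m) \<in> {1..K} \<times> UNIV \<times> {..<M}" "(k, n - int l, m) \<in> {1..K} \<times> UNIV \<times> {..<M}"
      using i k m by auto
    have X: "X (k, n, m) = b k n m" for k n m
      by (simp add: X_def)
    have "integrable \<Omega> (\<lambda>\<omega>. b i (n - int j) m \<omega> * cnj (b k (n - int l) m \<omega>))"
      using expectation_mult_cnj_indep(1)[OF ind sq mean mem] by (simp only: X)
    moreover have "expectation (\<lambda>\<omega>. b i (n - int j) m \<omega> * cnj (b k (n - int l) m \<omega>)) = (if i = k \<and> j = l then 1 else 0)"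
      using expectation_mult_cnj_indep(2)[OF ind sq mean mem] by (simp only: X noise_moments(5)[OF i m]) simp
    ultimately show ?thesis
      by (simp add: has_bochner_integral_iff)
  qed
  have expand: "noise_part p n i m \<omega> * cnj (noise_part p n k m \<omega>) =
      (\<Sum>j<p + 1. \<Sum>l<p + 1. c i j * c k l * (b i (n - int j) m \<omega> * cnj (b k (n - int l) m \<omega>)))" for \<omega>
  proof -
    have "cnj (noise_part p n k m \<omega>) = (\<Sum>l<p + 1. c k l * cnj (b k (n - int l) m \<omega>))"
      unfolding noise_part_def c_def by (simp only: cnj_sum complex_cnj_mult complex_cnj_complex_of_real)
    then show ?thesis
      unfolding noise_part_def c_def[symmetric] by (simp only: sum_product mult_ac)
  qed
  have "has_bochner_integral \<Omega> (\<lambda>\<omega>. noise_part p n i m \<omega> * cnj (noise_part p n k m \<omega>))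
      (\<Sum>j<p + 1. \<Sum>l<p + 1. c i j * c k l * (if i = k \<and> j = l then 1 else 0))"
    unfolding expand by (intro has_bochner_integral_sum has_bochner_integral_mult_right bb)
  moreover have "(\<Sum>j<p + 1. \<Sum>l<p + 1. c i j * c k l * (if i = k \<and> j = l then 1 else 0))
      = (if i = k then of_real (noise_part_power p k) else 0)"
  proof (cases "i = k")
    case True
    have "(\<Sum>j<p + 1. \<Sum>l<p + 1. c k j * c k l * (if j = l then 1 else 0)) = (\<Sum>j<p + 1. (c k j)\<^sup>2)"
      by (rule sum.cong) (auto simp: power2_eq_square if_distrib cong: if_cong simp del: sum.lessThan_Suc)
    then show ?thesis
      using True by (simp add: noise_part_power_def c_def del: sum.lessThan_Suc)
  qed simp
  ultimately show ?thesis by simp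
qed

text \<open>For distinct antennas the products are functions of disjoint blocks of the noise family.
  A block contains all users and lags, so both factors live on the same block whether or not
  \<open>i = k\<close>. The constant \<open>c\<close> allows for centring.\<close>

lemma indep_noise_part_products:
  assumes i: "i \<in> {1..K}" and k: "k \<in> {1..K}"
  shows "indep_vars (\<lambda>_. borel) (\<lambda>m \<omega>. noise_part p n i m \<omega> * cnj (noise_part p n k m \<omega>) - c) {..<M}"
proof -
  define I where "I m = {1..K} \<times> (\<lambda>j. n - int j) ` {..<p + 1} \<times> {m}" for m :: nat
  define X where "X m \<omega> = restrict (\<lambda>x. (case x of (k, n, m) \<Rightarrow> b k n m) \<omega>) (I m)" for m \<omega>
  define f where "f k m y = (\<Sum>j<p + 1. complex_of_real (\<alpha> * \<beta> k * \<alpha> ^ j) * y (k, n - int j, m))"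
    for k m and y :: "nat \<times> int \<times> nat \<Rightarrow> complex"
  have ind: "indep_vars (\<lambda>m. PiM (I m) (\<lambda>_. borel)) X {..<M}"
    unfolding X_def [abs_def] by (rule indep_vars_restrict[OF noise_indep]) (auto simp: I_def disjoint_family_on_def)
  have f: "f k m \<in> borel_measurable (PiM (I m) (\<lambda>_. borel))" if "k \<in> {1..K}" for k m
  proof -
    have "(\<lambda>y. y (k, n - int j, m)) \<in> borel_measurable (PiM (I m) (\<lambda>_. borel))" if "j < p + 1" for j
      using that \<open>k \<in> _\<close> by (intro measurable_component_singleton) (auto simp: I_def)
    then show ?thesis
      unfolding f_def [abs_def] by (intro borel_measurable_sum borel_measurable_times) auto
  qed
  have "indep_vars (\<lambda>_. borel) (\<lambda>m \<omega>. f i m (X m \<omega>) * cnj (f k m (X m \<omega>)) - c) {..<M}"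
  proof (rule indep_vars_compose2[OF ind, where Y = "\<lambda>m y. f i m y * cnj (f k m y) - c"])
    show "(\<lambda>y. f i m y * cnj (f k m y) - c) \<in> borel_measurable (PiM (I m) (\<lambda>_. borel))" for m
      using f[OF i] f[OF k]
      by (intro borel_measurable_diff borel_measurable_times measurable_compose[OF _ borel_measurable_continuous_onI[of cnj]]) (auto intro: continuous_on_cnj)
  qed
  moreover have "f k m (X m \<omega>) = noise_part p n k m \<omega>" if "k \<in> {1..K}" for k m \<omega>
    unfolding f_def noise_part_def using that by (intro sum.cong refl) (auto simp: X_def I_def)
  ultimately show ?thesis
    using i k by simp
qed

text \<open>One variance computation with two uses: \<open>i = k\<close>, centred at the mean power,
  is the weak law for the squared norm; \<open>i \<noteq> k\<close>, where the mean is 0, is the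
  bound on the interference.\<close>

lemma expectation_noise_part_sum_square:
  fixes p :: nat and n :: int
  assumes i: "i \<in> {1..K}" and k: "k \<in> {1..K}" and B: "\<And>i. i \<in> {1..K} \<Longrightarrow> \<beta> i \<le> B"
  defines "c \<equiv> if i = k then noise_part_power p k else 0"
  defines "W \<equiv> \<lambda>m \<omega>. noise_part p n i m \<omega> * cnj (noise_part p n k m \<omega>) - of_real c"
  shows "integrable \<Omega> (\<lambda>\<omega>. (cmod (\<Sum>m<M. W m \<omega>))\<^sup>2)"
    and "expectation (\<lambda>\<omega>. (cmod (\<Sum>m<M. W m \<omega>))\<^sup>2) \<le> real M * dominating_moment4 B p"
proof -
  define Z where "Z m \<omega> = noise_part p n i m \<omega> * cnj (noise_part p n k m \<omega>)" for m \<omega>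
  define D where "D = dominating_moment4 B p"
  have Z: "has_bochner_integral \<Omega> (Z m) (of_real c)" if "m < M" for m
    unfolding Z_def [abs_def] c_def using expectation_noise_part_mult[OF i k that, of p n] by (cases "i = k") simp_all
  have ind: "indep_vars (\<lambda>_. borel) W {..<M}"
    unfolding W_def by (rule indep_noise_part_products[OF i k])
  have Z4: "(cmod (Z m \<omega>))\<^sup>2 \<le> (dominating B p n i m \<omega> ^ 4 + dominating B p n k m \<omega> ^ 4) / 2" for m \<omega>
  proof -
    have "(cmod (Z m \<omega>))\<^sup>2 \<le> (dominating B p n i m \<omega> * dominating B p n k m \<omega>)\<^sup>2"
      unfolding Z_def norm_mult complex_mod_cnj
      using noise_part_le_dominating[OF i B[OF i], of p n m \<omega>] noise_part_le_dominating[OF k B[OF k], of p n m \<omega>]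
      by (intro power_mono mult_mono) (auto intro: order_trans[OF norm_ge_zero])
    also have "\<dots> \<le> (dominating B p n i m \<omega> ^ 4 + dominating B p n k m \<omega> ^ 4) / 2"
      using sum_squares_bound[of "(dominating B p n i m \<omega>)\<^sup>2" "(dominating B p n k m \<omega>)\<^sup>2"]
      by (simp add: power_mult_distrib flip: power_mult)
    finally show ?thesis .
  qed
  have Z2: "integrable \<Omega> (\<lambda>\<omega>. (cmod (Z m \<omega>))\<^sup>2)" and EZ2: "expectation (\<lambda>\<omega>. (cmod (Z m \<omega>))\<^sup>2) \<le> D" if m: "m < M" for m
  proof -
    have int: "integrable \<Omega> (\<lambda>\<omega>. (dominating B p n i m \<omega> ^ 4 + dominating B p n k m \<omega> ^ 4) / 2)"
      using expectation_dominating_power4(1)[OF i m] expectation_dominating_power4(1)[OF k m] by auto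
    have [measurable]: "Z m \<in> borel_measurable \<Omega>"
      using Z[OF m] by (auto dest: integrable.intros)
    show 1: "integrable \<Omega> (\<lambda>\<omega>. (cmod (Z m \<omega>))\<^sup>2)"
      by (rule Bochner_Integration.integrable_bound[OF int]) (use Z4 in \<open>auto intro!: AE_I2 order_trans[OF _ abs_ge_self]\<close>)
    have "expectation (\<lambda>\<omega>. (cmod (Z m \<omega>))\<^sup>2) \<le> expectation (\<lambda>\<omega>. (dominating B p n i m \<omega> ^ 4 + dominating B p n k m \<omega> ^ 4) / 2)"
      using 1 int Z4 by (intro integral_mono) auto
    also have "\<dots> = (expectation (\<lambda>\<omega>. dominating B p n i m \<omega> ^ 4) + expectation (\<lambda>\<omega>. dominating B p n k m \<omega> ^ 4)) / 2"
      using expectation_dominating_power4(1)[OF i m] expectation_dominating_power4(1)[OF k m] by simp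
    also have "\<dots> \<le> D"
      using expectation_dominating_power4(2)[OF i m, of B p n] expectation_dominating_power4(2)[OF k m, of B p n]
      by (simp add: D_def)
    finally show "expectation (\<lambda>\<omega>. (cmod (Z m \<omega>))\<^sup>2) \<le> D" .
  qed
  have W2_eq: "(cmod (W m \<omega>))\<^sup>2 = (cmod (Z m \<omega>))\<^sup>2 - 2 * c * Re (Z m \<omega>) + c\<^sup>2" for m \<omega>
    unfolding W_def Z_def[symmetric] by (simp only: cmod_power2) (simp add: power2_eq_square algebra_simps)
  have W: "integrable \<Omega> (\<lambda>\<omega>. (cmod (W m \<omega>))\<^sup>2)" "expectation (\<lambda>\<omega>. (cmod (W m \<omega>))\<^sup>2) \<le> D" "expectation (W m) = 0" if m: "m < M" for m
  proof -
    have ZI: "integrable \<Omega> (Z m)" "expectation (Z m) = of_real c"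
      using Z[OF m] by (simp_all add: has_bochner_integral_iff)
    show "integrable \<Omega> (\<lambda>\<omega>. (cmod (W m \<omega>))\<^sup>2)"
      unfolding W2_eq using Z2[OF m] ZI by auto
    have "expectation (\<lambda>\<omega>. (cmod (W m \<omega>))\<^sup>2) = expectation (\<lambda>\<omega>. (cmod (Z m \<omega>))\<^sup>2) - 2 * c * c + c\<^sup>2"
      unfolding W2_eq using Z2[OF m] ZI by (simp add: prob_space integral_Re)
    \<comment> \<open>Centring at the mean only lowers the second moment.\<close>
    also have "\<dots> = expectation (\<lambda>\<omega>. (cmod (Z m \<omega>))\<^sup>2) - c\<^sup>2"
      by (simp add: power2_eq_square)
    also have "\<dots> \<le> D"
      using EZ2[OF m] zero_le_power2[of c] by linarith
    finally show "expectation (\<lambda>\<omega>. (cmod (W m \<omega>))\<^sup>2) \<le> D" .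
    show "expectation (W m) = 0"
      unfolding W_def Z_def[symmetric] using ZI by (simp add: prob_space)
  qed
  note sums = expectation_norm_sum_square_indep[OF finite_lessThan ind]
  show "integrable \<Omega> (\<lambda>\<omega>. (cmod (\<Sum>m<M. W m \<omega>))\<^sup>2)"
    by (rule sums(1)) (use W in auto)
  have "expectation (\<lambda>\<omega>. (cmod (\<Sum>m<M. W m \<omega>))\<^sup>2) = (\<Sum>m<M. expectation (\<lambda>\<omega>. (cmod (W m \<omega>))\<^sup>2))"
    by (rule sums(2)) (use W in auto)
  also have "\<dots> \<le> real (card {..<M}) * D"
    using W(2) by (intro sum_bounded_above) auto
  finally show "expectation (\<lambda>\<omega>. (cmod (\<Sum>m<M. W m \<omega>))\<^sup>2) \<le> real M * dominating_moment4 B p"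
    by (simp add: D_def)
qed

text \<open>The smallness conditions are, in order, the contraction condition for all users at once,
  the bound that lets powers of \<open>p_p\<close> be discarded, and the condition that keeps the
  denominator factor \<open>d\<close> within \<open>1 / 2\<close> of 1. The term
  \<open>2 * real K * B\<close> adds the prediction error bound over the users.\<close>

lemma mrc_rate_approx:
  fixes p :: nat and n :: int
  assumes k: "k \<in> {1..K}" and B: "\<And>i. i \<in> {1..K} \<Longrightarrow> \<beta> i \<le> B"
    and small: "p_p * B * real (p + 1) \<le> 1 / 2" "p_p \<le> 1" "p_u * (2 * real K * B) \<le> 1 / 2"
  defines "D \<equiv> dominating_moment4 B p"
  shows "\<bar>mrc_rate p k n - log 2 (1 + p_u * p_p * real M * noise_part_power p k)\<bar> \<le>
    (p_u * p_p * sqrt (real M * D) + (3 * sqrt p_p + 8 * (p_u * (2 * real K * B))) * (p_u * p_p * (real M * D))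
     + 2 * p_u\<^sup>2 * (real K * (2 * p_p\<^sup>2 * (real M * D) + 18 * p_p ^ 3 * real M * (real M * D)))) / ln 2"
proof -
  note pp = p_p_pos[OF k]
  have D: "1 \<le> D"
    unfolding D_def by (rule dominating_moment4_ge_1)
  have small': "p_p * \<beta> i * real (p + 1) \<le> 1 / 2" if "i \<in> {1..K}" for i
  proof -
    have "p_p * \<beta> i * real (p + 1) \<le> p_p * B * real (p + 1)"
      using pp B[OF that] by (intro mult_right_mono mult_left_mono) auto
    then show ?thesis using small by simp
  qed
  define d where "d = p_u * (\<Sum>i = 1..K. 1 / real M *
      Re (mat_trace (complex_of_real (\<beta> i) \<cdot>\<^sub>m 1\<^sub>m M - complex_of_real (\<alpha>\<^sup>2) \<cdot>\<^sub>m \<Theta> p i))) + 1"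
  have d: "\<bar>d - 1\<bar> \<le> p_u * (2 * real K * B)"
  proof -
    have "\<bar>\<Sum>i = 1..K. 1 / real M *
      Re (mat_trace (complex_of_real (\<beta> i) \<cdot>\<^sub>m 1\<^sub>m M - complex_of_real (\<alpha>\<^sup>2) \<cdot>\<^sub>m \<Theta> p i))\<bar> \<le> (\<Sum>i = 1..K. 2 * B)"
    proof (rule order_trans[OF sum_abs], rule sum_mono)
      fix i assume i: "i \<in> {1..K}"
      show "\<bar>1 / real M * Re (mat_trace (complex_of_real (\<beta> i) \<cdot>\<^sub>m 1\<^sub>m M - complex_of_real (\<alpha>\<^sup>2) \<cdot>\<^sub>m \<Theta> p i))\<bar> \<le> 2 * B"
        using trace_prediction_error_bound[OF i small'[OF i]] B[OF i] by linarith
    qed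
    then have "p_u * \<bar>\<Sum>i = 1..K. 1 / real M *
      Re (mat_trace (complex_of_real (\<beta> i) \<cdot>\<^sub>m 1\<^sub>m M - complex_of_real (\<alpha>\<^sup>2) \<cdot>\<^sub>m \<Theta> p i))\<bar> \<le> p_u * (\<Sum>i = 1..K. 2 * B)"
      using power_pos by (intro mult_left_mono) auto
    then show ?thesis
      using power_pos by (simp add: d_def abs_mult mult_ac)
  qed
  define G where "G i m \<omega> = predicted_channel p i n \<omega> $ m" for i m \<omega>
  have G_meas: "G i m \<in> borel_measurable \<Omega>" if i: "i \<in> {1..K}" and m: "m < M" for i m
    unfolding G_def [abs_def] predicted_channel_index[OF i small'[OF i] m]
    using channel_measurable[OF i m] noise_measurable[OF i m]
    by (intro borel_measurable_sum borel_measurable_times borel_measurable_add) auto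
  have prod_eq: "predicted_channel p i n \<omega> \<bullet>c predicted_channel p k n \<omega> = (\<Sum>m<M. G i m \<omega> * cnj (G k m \<omega>))"
    if i: "i \<in> {1..K}" for i \<omega>
    unfolding G_def by (intro conjugate_scalar_prod_eq_sum dim_predicted_channel i k small')
  have norm_eq: "sq_norm_cvec (predicted_channel p k n \<omega>) = (\<Sum>m<M. (cmod (G k m \<omega>))\<^sup>2)" for \<omega>
    unfolding sq_norm_cvec_def G_def dim_predicted_channel[OF k small'[OF k]] ..
  have sinr_eq: "sinr p k n (predicted_channel p k n \<omega>) \<omega> = p_u * (cmod (\<Sum>m<M. G k m \<omega> * cnj (G k m \<omega>)))\<^sup>2 /
      (p_u * (\<Sum>i\<in>{1..K} - {k}. (cmod (\<Sum>m<M. G i m \<omega> * cnj (G k m \<omega>)))\<^sup>2) + (\<Sum>m<M. (cmod (G k m \<omega>))\<^sup>2) * d)" for \<omega>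
  proof -
    have "(\<Sum>i\<in>{1..K} - {k}. (cmod (predicted_channel p i n \<omega> \<bullet>c predicted_channel p k n \<omega>))\<^sup>2)
      = (\<Sum>i\<in>{1..K} - {k}. (cmod (\<Sum>m<M. G i m \<omega> * cnj (G k m \<omega>)))\<^sup>2)"
      by (intro sum.cong refl arg_cong[where f = "\<lambda>z. (cmod z)\<^sup>2"] prod_eq) blast
    then show ?thesis
      unfolding sinr_def norm_eq d_def prod_eq[OF k] by (rule arg_cong)
  qed
  have s: "0 \<le> noise_part_power p k"
    unfolding noise_part_power_def by (intro sum_nonneg) auto
  have V: "integrable \<Omega> (\<lambda>\<omega>. (\<Sum>m<M. (cmod (noise_part p n k m \<omega>))\<^sup>2 - noise_part_power p k)\<^sup>2)"
    "expectation (\<lambda>\<omega>. (\<Sum>m<M. (cmod (noise_part p n k m \<omega>))\<^sup>2 - noise_part_power p k)\<^sup>2) \<le> real M * D"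
  proof -
    have "(cmod (\<Sum>m<M. noise_part p n k m \<omega> * cnj (noise_part p n k m \<omega>) - of_real (noise_part_power p k)))\<^sup>2
      = (\<Sum>m<M. (cmod (noise_part p n k m \<omega>))\<^sup>2 - noise_part_power p k)\<^sup>2" for \<omega>
      by (simp only: complex_norm_square[symmetric] of_real_diff[symmetric] of_real_sum[symmetric] norm_of_real power2_abs)
    then show "integrable \<Omega> (\<lambda>\<omega>. (\<Sum>m<M. (cmod (noise_part p n k m \<omega>))\<^sup>2 - noise_part_power p k)\<^sup>2)"
      "expectation (\<lambda>\<omega>. (\<Sum>m<M. (cmod (noise_part p n k m \<omega>))\<^sup>2 - noise_part_power p k)\<^sup>2) \<le> real M * D"
      using expectation_noise_part_sum_square[OF k k B, where p = p and n = n] by (simp_all only: if_True simp_thms D_def)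
  qed
  have W: "integrable \<Omega> (\<lambda>\<omega>. (cmod (\<Sum>m<M. noise_part p n i m \<omega> * cnj (noise_part p n k m \<omega>)))\<^sup>2)"
    "expectation (\<lambda>\<omega>. (cmod (\<Sum>m<M. noise_part p n i m \<omega> * cnj (noise_part p n k m \<omega>)))\<^sup>2) \<le> real M * D"
    if "i \<in> {1..K} - {k}" for i
    using expectation_noise_part_sum_square[OF _ k B, where p = p and n = n and i = i] that by (simp_all add: D_def)
  have "\<bar>mrc_rate p k n - log 2 (1 + p_u * p_p * real M * noise_part_power p k)\<bar> \<le>
    (p_u * p_p * sqrt (real M * D) + (3 * sqrt p_p + 8 * \<bar>d - 1\<bar>) * (p_u * p_p * (real M * D))
     + 2 * p_u\<^sup>2 * (real (card {1..K}) * (2 * p_p\<^sup>2 * (real M * D) + 18 * p_p ^ 3 * real M * (real M * D)))) / ln 2"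
    unfolding mrc_rate_def rate_def sinr_eq
  proof (rule mrc_log_rate_bound[where Z = "noise_part p n" and H = "dominating B p n" and G = G])
    show "cmod (G i m \<omega> - of_real (sqrt p_p) * noise_part p n i m \<omega>) \<le> p_p * dominating B p n i m \<omega>"
      if "i \<in> {1..K}" "m < M" for i m \<omega>
      unfolding G_def using prediction_approx_noise_part[OF that(1) B small(1,2) that(2)] that by blast
    show "\<bar>d - 1\<bar> \<le> 1 / 2"
      using d small by linarith
    show "expectation (\<lambda>\<omega>. dominating B p n i m \<omega> ^ 4) \<le> D" if "i \<in> {1..K}" "m < M" for i m
      unfolding D_def by (rule expectation_dominating_power4(2)[OF that])
  qed (use k power_pos pp small D s V W G_meas B in \<open>auto intro: noise_part_measurable dominating_measurable
        noise_part_le_dominating expectation_dominating_power4\<close>)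
  also have "\<dots> \<le> (p_u * p_p * sqrt (real M * D) + (3 * sqrt p_p + 8 * (p_u * (2 * real K * B))) * (p_u * p_p * (real M * D))
     + 2 * p_u\<^sup>2 * (real K * (2 * p_p\<^sup>2 * (real M * D) + 18 * p_p ^ 3 * real M * (real M * D)))) / ln 2"
    using d D power_pos pp
    by (intro divide_right_mono add_mono mult_right_mono mult_left_mono) auto
  finally show ?thesis .
qed

end

section \<open>The limit of many antennas\<close>

lemma mrc_rate_tendsto:
  fixes K \<tau> p :: nat
    and \<alpha> :: real
    and \<beta> :: "nat \<Rightarrow> real"
    and \<Omega> :: "nat \<Rightarrow> 'w measure"
    and p_u :: "nat \<Rightarrow> real"
    and g e b :: "nat \<Rightarrow> nat \<Rightarrow> int \<Rightarrow> nat \<Rightarrow> 'w \<Rightarrow> complex"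
    and n :: int
  assumes up: "\<And>M. K \<le> M \<Longrightarrow> uplink (\<Omega> M) M K \<tau> (p_u M) \<alpha> \<beta> (g M) (e M) (b M)"
    and k: "k \<in> {1..K}"
    and p0: "p_u \<longlonglongrightarrow> 0" and p2: "(\<lambda>M. (p_u M)\<^sup>2 * real M) \<longlonglongrightarrow> \<kappa>" and \<kappa>: "0 \<le> \<kappa>"
  shows "(\<lambda>M. uplink.mrc_rate (\<Omega> M) M K \<tau> (p_u M) \<alpha> \<beta> (g M) (b M) p k n)
    \<longlonglongrightarrow> log 2 (1 + \<alpha>\<^sup>2 * (\<Sum>j = 0..p. \<alpha> ^ (2 * j) * real \<tau> * \<kappa> * (\<beta> k)\<^sup>2))"
proof -
  define B where "B = (\<Sum>i = 1..K. \<beta> i)"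
  \<comment> \<open>Positivity of the fading constants can be read off from any one system, here the
    one with \<open>M = K\<close>.\<close>
  have beta_pos: "0 < \<beta> i" if "i \<in> {1..K}" for i
    using uplink.fading_pos[OF up[OF order_refl] that] .
  have B: "\<beta> i \<le> B" if "i \<in> {1..K}" for i
    unfolding B_def using that beta_pos by (intro member_le_sum) (auto intro: less_imp_le)
  define s where "s = (\<Sum>j<p + 1. (\<alpha> * \<beta> k * \<alpha> ^ j)\<^sup>2)"
  have s: "0 \<le> s"
    unfolding s_def by (intro sum_nonneg) auto
  \<comment> \<open>The value of \<open>dominating_moment4\<close>, written out so that one constant
    serves the systems for all \<open>M\<close>.\<close>
  define D where "D = 1 + (2 * B + 2 * real (p + 1) * B\<^sup>2) ^ 4 * (8 * real (p + 1) ^ 4 *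
     ((\<Sum>i=1..K. complex_normal_moment4 (\<beta> i)) + complex_normal_moment4 1))"
  define P where "P M = (p_u M)\<^sup>2 * real M" for M
  \<comment> \<open>The error bound rewritten through the convergent \<open>P M\<close>, which
    leaves in each summand a factor tending to 0. The interference terms, of orders
    \<open>p_u^4 * M\<close> and \<open>p_u^5 * M^2\<close>, become \<open>P * p_u^2\<close> and
    \<open>P^2 * p_u\<close>.\<close>
  define R where "R M = (real \<tau> * P M * sqrt D * (1 / sqrt (real M))
      + (3 * sqrt (real \<tau> * p_u M) + 8 * (p_u M * (2 * real K * B))) * (real \<tau> * P M * D)
      + real K * (4 * (real \<tau>)\<^sup>2 * P M * (p_u M)\<^sup>2 * D + 36 * (real \<tau>) ^ 3 * (P M)\<^sup>2 * p_u M * D)) / ln 2" for M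
  have lim0: "(\<lambda>M. 1 / sqrt (real M)) \<longlonglongrightarrow> 0"
    by real_asymp
  note p2 = p2[folded P_def]
  have "R \<longlonglongrightarrow> (real \<tau> * \<kappa> * sqrt D * 0
      + (3 * sqrt (real \<tau> * 0) + 8 * (0 * (2 * real K * B))) * (real \<tau> * \<kappa> * D)
      + real K * (4 * (real \<tau>)\<^sup>2 * \<kappa> * 0\<^sup>2 * D + 36 * (real \<tau>) ^ 3 * \<kappa>\<^sup>2 * 0 * D)) / ln 2"
    unfolding R_def [abs_def] by (intro tendsto_intros lim0 p0 p2) auto
  then have R0: "R \<longlonglongrightarrow> 0" by simp
  have "(\<lambda>M. real \<tau> * p_u M * B * real (p + 1)) \<longlonglongrightarrow> real \<tau> * 0 * B * real (p + 1)"
    by (intro tendsto_intros p0)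
  then have ev1: "\<forall>\<^sub>F M in sequentially. real \<tau> * p_u M * B * real (p + 1) < 1 / 2"
    by (rule order_tendstoD) simp
  have "(\<lambda>M. real \<tau> * p_u M) \<longlonglongrightarrow> real \<tau> * 0"
    by (intro tendsto_intros p0)
  then have ev2: "\<forall>\<^sub>F M in sequentially. real \<tau> * p_u M < 1"
    by (rule order_tendstoD) simp
  have "(\<lambda>M. p_u M * (2 * real K * B)) \<longlonglongrightarrow> 0 * (2 * real K * B)"
    by (intro tendsto_intros p0)
  then have ev3: "\<forall>\<^sub>F M in sequentially. p_u M * (2 * real K * B) < 1 / 2"
    by (rule order_tendstoD) simp
  have "\<forall>\<^sub>F M in sequentially.
    \<bar>uplink.mrc_rate (\<Omega> M) M K \<tau> (p_u M) \<alpha> \<beta> (g M) (b M) p k n - log 2 (1 + real \<tau> * P M * s)\<bar> \<le> R M"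
    using ev1 ev2 ev3 eventually_ge_at_top[of K]
  proof eventually_elim
    case (elim M)
    interpret uplink "\<Omega> M" M K \<tau> "p_u M" \<alpha> \<beta> "g M" "e M" "b M"
      by (rule up) fact
    have M: "0 < real M"
      using antennas_pos[OF k] by simp
    have D': "dominating_moment4 B p = D"
      unfolding dominating_moment4_def D_def ..
    have s': "noise_part_power p k = s"
      unfolding noise_part_power_def s_def ..
    have 1: "p_u M * p_p * real M * s = real \<tau> * P M * s"
      by (simp add: P_def p_p_def power2_eq_square)
    have "p_u M * p_p * sqrt (real M * D) = real \<tau> * P M * sqrt D * (1 / sqrt (real M))"
      using M by (simp add: P_def p_p_def power2_eq_square real_sqrt_mult field_simps)
    moreover have "p_u M * p_p * (real M * D) = real \<tau> * P M * D"
      by (simp add: P_def p_p_def power2_eq_square)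
    moreover have "2 * (p_u M)\<^sup>2 * (real K * (2 * p_p\<^sup>2 * (real M * D) + 18 * p_p ^ 3 * real M * (real M * D)))
      = real K * (4 * (real \<tau>)\<^sup>2 * P M * (p_u M)\<^sup>2 * D + 36 * (real \<tau>) ^ 3 * (P M)\<^sup>2 * p_u M * D)"
      by (simp add: P_def p_p_def power2_eq_square power3_eq_cube algebra_simps)
    moreover have pp: "p_p = real \<tau> * p_u M"
      by (rule p_p_def)
    have "p_p * B * real (p + 1) \<le> 1 / 2" "p_p \<le> 1" "p_u M * (2 * real K * B) \<le> 1 / 2"
      using elim by (simp_all only: pp less_imp_le)
    note mrc_rate_approx[OF k B this, where n = n, unfolded D' s' 1]
    ultimately show ?case
      by (simp only: R_def pp)
  qed
  then have "(\<lambda>M. uplink.mrc_rate (\<Omega> M) M K \<tau> (p_u M) \<alpha> \<beta> (g M) (b M) p k n - log 2 (1 + real \<tau> * P M * s)) \<longlonglongrightarrow> 0"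
    by (intro Lim_null_comparison[OF _ R0]) simp
  moreover have "(\<lambda>M. log 2 (1 + real \<tau> * P M * s)) \<longlonglongrightarrow> log 2 (1 + real \<tau> * \<kappa> * s)"
  proof -
    have "0 \<le> real \<tau> * \<kappa> * s" using \<kappa> s by simp
    then show ?thesis by (intro tendsto_intros p2) auto
  qed
  ultimately have "(\<lambda>M. uplink.mrc_rate (\<Omega> M) M K \<tau> (p_u M) \<alpha> \<beta> (g M) (b M) p k n) \<longlonglongrightarrow> log 2 (1 + real \<tau> * \<kappa> * s)"
    using tendsto_add by fastforce
  moreover have "real \<tau> * \<kappa> * s = \<alpha>\<^sup>2 * (\<Sum>j = 0..p. \<alpha> ^ (2 * j) * real \<tau> * \<kappa> * (\<beta> k)\<^sup>2)"
    unfolding s_def sum_distrib_left atLeast0AtMost Suc_eq_plus1[symmetric] lessThan_Suc_atMost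
    by (intro sum.cong refl) (simp add: power_mult_distrib power_mult[symmetric] mult_ac)
  ultimately show ?thesis by simp
qed

theorem corollary2:
  fixes K \<tau> p :: nat
    and \<alpha> E_u :: real
    and \<beta> :: "nat \<Rightarrow> real"
    and \<Omega> :: "nat \<Rightarrow> 'w measure"
    and p_u :: "nat \<Rightarrow> real"
    and g e b :: "nat \<Rightarrow> nat \<Rightarrow> int \<Rightarrow> nat \<Rightarrow> 'w \<Rightarrow> complex"
    and n :: int
  assumes "0 < E_u"
    and "\<And>M. K \<le> M \<Longrightarrow> uplink (\<Omega> M) M K \<tau> (p_u M) \<alpha> \<beta> (g M) (e M) (b M)"
  shows "\<forall>k \<in> {1..K}.
      ((\<forall>M\<ge>K. p_u M = E_u / sqrt (real M)) \<longrightarrow>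
         (\<lambda>M. uplink.mrc_rate (\<Omega> M) M K \<tau> (p_u M) \<alpha> \<beta> (g M) (b M) p k n)
           \<longlonglongrightarrow> log 2 (1 + \<alpha>\<^sup>2 * (\<Sum>j = 0..p. \<alpha> ^ (2 * j) * real \<tau> * E_u\<^sup>2 * (\<beta> k)\<^sup>2))) \<and>
      (\<forall>\<gamma>>1/2. (\<forall>M\<ge>K. p_u M = E_u / real M powr \<gamma>) \<longrightarrow>
         (\<lambda>M. uplink.mrc_rate (\<Omega> M) M K \<tau> (p_u M) \<alpha> \<beta> (g M) (b M) p k n) \<longlonglongrightarrow> 0)"
proof (intro ballI conjI allI impI)
  fix k assume k: "k \<in> {1..K}" and p_u: "\<forall>M\<ge>K. p_u M = E_u / sqrt (real M)"
  \<comment> \<open>The power law is prescribed only from \<open>K\<close> on, hence the passage to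
    eventual equality.\<close>
  have ev: "\<forall>\<^sub>F M in sequentially. E_u / sqrt (real M) = p_u M"
    by (rule eventually_mono[OF eventually_ge_at_top[of K]]) (simp add: p_u)
  have "(\<lambda>M. E_u / sqrt (real M)) \<longlonglongrightarrow> 0"
    by real_asymp
  then have 1: "p_u \<longlonglongrightarrow> 0"
    by (rule Lim_transform_eventually[OF _ ev])
  have 2: "(\<lambda>M. (p_u M)\<^sup>2 * real M) \<longlonglongrightarrow> E_u\<^sup>2"
  proof (rule tendsto_eventually)
    show "\<forall>\<^sub>F M in sequentially. (p_u M)\<^sup>2 * real M = E_u\<^sup>2"
      using ev eventually_gt_at_top[of 0] by eventually_elim (auto simp: power_divide dest!: sym[of "_ / _"])
  qed
  show "(\<lambda>M. uplink.mrc_rate (\<Omega> M) M K \<tau> (p_u M) \<alpha> \<beta> (g M) (b M) p k n)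
           \<longlonglongrightarrow> log 2 (1 + \<alpha>\<^sup>2 * (\<Sum>j = 0..p. \<alpha> ^ (2 * j) * real \<tau> * E_u\<^sup>2 * (\<beta> k)\<^sup>2))"
    by (rule mrc_rate_tendsto[OF assms(2) k 1 2]) auto
next
  fix k and \<gamma> :: real assume k: "k \<in> {1..K}" and \<gamma>: "1 / 2 < \<gamma>" and p_u: "\<forall>M\<ge>K. p_u M = E_u / real M powr \<gamma>"
  have ev: "\<forall>\<^sub>F M in sequentially. E_u / real M powr \<gamma> = p_u M"
    by (rule eventually_mono[OF eventually_ge_at_top[of K]]) (simp add: p_u)
  have "(\<lambda>M. E_u / real M powr \<gamma>) \<longlonglongrightarrow> 0"
    using \<gamma> by real_asymp
  then have 1: "p_u \<longlonglongrightarrow> 0"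
    by (rule Lim_transform_eventually[OF _ ev])
  \<comment> \<open>Here \<open>p_u^2 * M\<close> equals \<open>E_u^2\<close> times this power of
    \<open>M\<close>, so \<open>\<gamma> = 1/2\<close> is the threshold at which it stops
    vanishing.\<close>
  have "1 - 2 * \<gamma> < 0"
    using \<gamma> by simp
  then have "(\<lambda>M. E_u\<^sup>2 * real M powr (1 - 2 * \<gamma>)) \<longlonglongrightarrow> 0"
    by real_asymp
  moreover have "\<forall>\<^sub>F M in sequentially. E_u\<^sup>2 * real M powr (1 - 2 * \<gamma>) = (p_u M)\<^sup>2 * real M"
    using ev eventually_gt_at_top[of 0]
  proof eventually_elim
    case (elim M)
    have "real M powr (2 * \<gamma>) = (real M powr \<gamma>)\<^sup>2"
      by (simp add: power2_eq_square flip: powr_add)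
    then show ?case
      using elim(2) unfolding elim(1)[symmetric] by (simp add: powr_diff power_divide)
  qed
  ultimately have 2: "(\<lambda>M. (p_u M)\<^sup>2 * real M) \<longlonglongrightarrow> 0"
    by (rule Lim_transform_eventually)
  show "(\<lambda>M. uplink.mrc_rate (\<Omega> M) M K \<tau> (p_u M) \<alpha> \<beta> (g M) (b M) p k n) \<longlonglongrightarrow> 0"
    using mrc_rate_tendsto[OF assms(2) k 1 2] by simp
qed

end
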